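(* Let $R$ be a commutative, unital, complex, semisimple Banach algebra with an involution $\cdot^\star$, let $M(R)$ be its maximal ideal space, and let $n,m,p$ be positive integers. Let $A\in R^{n\times n}$, $B\in R^{n\times m}$, $C\in R^{p\times n}$ satisfy the following for all $\varphi\in M(R)$: (A1) $\widehat{(A^\star)}(\varphi)=(\widehat{A}(\varphi))^*$; (A2) $\widehat{(BB^\star)}(\varphi)=\widehat{B}(\varphi)(\widehat{B}(\varphi))^*$; (A3) $\widehat{(C^\star C)}(\varphi)=(\widehat{C}(\varphi))^*\widehat{C}(\varphi)$; (A4) $(\widehat{A}(\varphi),\widehat{B}(\varphi))$ is stabilizable; (A5) $(\widehat{A}(\varphi),\widehat{C}(\varphi))$ is detectable. Then there exists a $P\in R^{n\times n}$ such that (1) $PBB^\star P-PA-A^\star P-C^\star C=0$; (2) $A-BB^\star P$ is exponentially stable; and (3) for all $\varphi\in M(R)$, the matrix $\widehat{P}(\varphi)\in\mathbb{C}^{n\times n}$ is positive semidefinite.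
   Context: An involution $\cdot^\star$ on $R$ is a map $R\to R$ that is conjugate-linear with $(xy)^\star=y^\star x^\star$ and $(x^\star)^\star=x$. $M(R)$ is the set of all complex homomorphisms (nonzero multiplicative linear functionals) $\varphi:R\to\mathbb{C}$, with the weak-$\ast$ topology. The Gelfand transform of $x\in R$ is $\widehat{x}(\varphi)=\varphi(x)$, $\varphi\in M(R)$. For a matrix $M=[m_{ij}]\in R^{p\times m}$: $M^\star=[m_{ji}^\star]\in R^{m\times p}$, and $\widehat{M}(\varphi)=[\widehat{m_{ij}}(\varphi)]\in\mathbb{C}^{p\times m}$. For a complex matrix $N$, $N^*$ denotes the usual conjugate transpose. For complex matrices $A_0\in\mathbb{C}^{n\times n}$, $B_0\in\mathbb{C}^{n\times m}$, $C_0\in\mathbb{C}^{p\times n}$: the pair $(A_0,B_0)$ is stabilizable if there is $F\in\mathbb{C}^{m\times n}$ such that all eigenvalues of $A_0+B_0F$ have negative real part; the pair $(A_0,C_0)$ is detectable if $(A_0^*,C_0^* )$ is stabilizable. $R^n$ carries the norm $\|x\|=\max_{1\le k\le n}\|x_k\|$, and $R^{n\times n}$ is a unital Banach algebra with the norm $\|A\|=\sup\{\|Av\|: v\in R^n,\ \|v\|\le 1\}$, the operator norm of the multiplication map $v\mapsto Av$ on $R^n$. For $A\in R^{n\times n}$, $e^{A}=\sum_{k=0}^\infty \frac{1}{k!}A^k$. A matrix $A\in R^{n\times n}$ is exponentially stable if there exist positive constants $K$ and $\epsilon$ such that $\|e^{tA}\|\le Ke^{-\epsilon t}$ for all $t\ge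 0$. *)

theory Defs
  imports "HOL-Analysis.Analysis" "HOL-Algebra.Algebraic_Closure_Type"
begin

text \<open>
  Commutative unital complex Banach algebras. Completeness, submultiplicativity of the norm and
  \<open>norm 1 = 1\<close> come from the real classes of the library; complex scalars are added on top,
  compatibly with the real ones.
\<close>

class comm_complex_banach_algebra_1 = banach + real_normed_algebra_1 + comm_ring_1 +
  fixes scaleC :: "complex \<Rightarrow> 'a \<Rightarrow> 'a"  (infixr "*\<^sub>C" 75)
  assumes scaleC_add_right: "c *\<^sub>C (x + y) = c *\<^sub>C x + c *\<^sub>C y"
    and scaleC_add_left: "(c + d) *\<^sub>C x = c *\<^sub>C x + d *\<^sub>C x"
    and scaleC_scaleC: "c *\<^sub>C d *\<^sub>C x = (c * d) *\<^sub>C x"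
    and scaleC_of_real: "complex_of_real r *\<^sub>C x = r *\<^sub>R x"
    and mult_scaleC_left: "(c *\<^sub>C x) * y = c *\<^sub>C (x * y)"
    and norm_scaleC: "norm (c *\<^sub>C x) = cmod c * norm x"

text \<open>
  Semisimplicity: the Jacobson radical, i.e. the intersection of all maximal ideals, is zero.
\<close>

definition semisimple :: "'a::comm_ring_1 itself \<Rightarrow> bool" where
  "semisimple _ \<longleftrightarrow> \<Inter>{I. maximalideal I (ring_of_type_algebra :: 'a ring)} = {0}"

definition involution :: "('a::comm_complex_banach_algebra_1 \<Rightarrow> 'a) \<Rightarrow> bool" where
  "involution star \<longleftrightarrow>
     (\<forall>x y. star (x + y) = star x + star y) \<and>
     (\<forall>c x. star (c *\<^sub>C x) = cnj c *\<^sub>C star x) \<and>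
     (\<forall>x y. star (x * y) = star y * star x) \<and>
     (\<forall>x. star (star x) = x)"

definition maximal_ideal_space :: "('a::comm_complex_banach_algebra_1 \<Rightarrow> complex) set" where
  "maximal_ideal_space =
     {\<phi>. (\<forall>x y. \<phi> (x + y) = \<phi> x + \<phi> y) \<and>
         (\<forall>c x. \<phi> (c *\<^sub>C x) = c * \<phi> x) \<and>
         (\<forall>x y. \<phi> (x * y) = \<phi> x * \<phi> y) \<and>
         (\<exists>x. \<phi> x \<noteq> 0)}"

definition gelfand :: "'a \<Rightarrow> ('a \<Rightarrow> complex) \<Rightarrow> complex" where
  "gelfand x \<phi> = \<phi> x"

text \<open>
  A matrix with rows indexed by \<open>'p\<close> and columns indexed by \<open>'m\<close> has type \<open>'a ^ 'm ^ 'p\<close>.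
\<close>

definition gelfand_mat :: "'a ^ 'm ^ 'p \<Rightarrow> ('a \<Rightarrow> complex) \<Rightarrow> complex ^ 'm ^ 'p" where
  "gelfand_mat M \<phi> = (\<chi> i j. gelfand (M $ i $ j) \<phi>)"

definition star_mat :: "('a \<Rightarrow> 'a) \<Rightarrow> 'a ^ 'm ^ 'p \<Rightarrow> 'a ^ 'p ^ 'm" where
  "star_mat star M = (\<chi> i j. star (M $ j $ i))"

definition conj_transpose :: "complex ^ 'm ^ 'p \<Rightarrow> complex ^ 'p ^ 'm" where
  "conj_transpose N = (\<chi> i j. cnj (N $ j $ i))"

definition mat_eigenvalue :: "complex ^ 'n ^ 'n \<Rightarrow> complex \<Rightarrow> bool" where
  "mat_eigenvalue N l \<longleftrightarrow> (\<exists>v. v \<noteq> 0 \<and> N *v v = l *s v)"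

definition stabilizable :: "complex ^ 'n ^ 'n \<Rightarrow> complex ^ 'm ^ 'n \<Rightarrow> bool" where
  "stabilizable A B \<longleftrightarrow>
     (\<exists>F :: complex ^ 'n ^ 'm. \<forall>l. mat_eigenvalue (A + B ** F) l \<longrightarrow> Re l < 0)"

definition detectable :: "complex ^ 'n ^ 'n \<Rightarrow> complex ^ 'n ^ 'p \<Rightarrow> bool" where
  "detectable A C \<longleftrightarrow> stabilizable (conj_transpose A) (conj_transpose C)"

text \<open>
  The quadratic form \<open>v\<^sup>* N v\<close> of a Hermitian matrix is real, so its real part is the form itself.
\<close>

definition pos_semidef :: "complex ^ 'n ^ 'n \<Rightarrow> bool" where
  "pos_semidef N \<longleftrightarrow>
     conj_transpose N = N \<and> (\<forall>v. 0 \<le> Re (\<Sum>i\<in>UNIV. cnj (v $ i) * (N *v v) $ i))"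

text \<open>
  The instance \<open>norm\<close> on \<open>'a ^ 'n\<close> is the Euclidean norm, and on \<open>'a ^ 'n ^ 'n\<close> it is of
  Frobenius type; the maximum norm and its operator norm are therefore defined separately. They are
  equivalent to the instance norms, so the series \<open>mat_exp\<close> has the same sum for either.
  Similarly, powers in \<open>'a ^ 'n ^ 'n\<close> are entrywise and cannot be used for \<open>mat_pow\<close>.
\<close>

definition max_norm :: "'a::real_normed_vector ^ 'n \<Rightarrow> real" where
  "max_norm x = (MAX k. norm (x $ k))"

definition op_norm :: "'a::real_normed_algebra_1 ^ 'n ^ 'n \<Rightarrow> real" where
  "op_norm A = (SUP v\<in>{v. max_norm v \<le> 1}. max_norm (A *v v))"

primrec mat_pow :: "'a::semiring_1 ^ 'n ^ 'n \<Rightarrow> nat \<Rightarrow> 'a ^ 'n ^ 'n" where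
  "mat_pow A 0 = mat 1"
| "mat_pow A (Suc k) = A ** mat_pow A k"

definition mat_exp :: "'a::real_normed_algebra_1 ^ 'n ^ 'n \<Rightarrow> 'a ^ 'n ^ 'n" where
  "mat_exp A = (\<Sum>k. (1 / fact k) *\<^sub>R mat_pow A k)"

definition exponentially_stable :: "'a::real_normed_algebra_1 ^ 'n ^ 'n \<Rightarrow> bool" where
  "exponentially_stable A \<longleftrightarrow>
     (\<exists>K>0. \<exists>\<epsilon>>0. \<forall>t\<ge>0. op_norm (mat_exp (t *\<^sub>R A)) \<le> K * exp (- \<epsilon> * t))"

end

theory Submission
  imports Defs
begin

text \<open>
  The Hamiltonian matrix \<open>H = [[A, - B B\<^sup>\<star>], [- C\<^sup>\<star> C, - A\<^sup>\<star>]]\<close> over the Banach algebra has a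
  Gelfand transform without imaginary eigenvalues, so \<open>exp H\<close> has no spectrum on the unit circle.
  The matrices \<open>(1 - exp (2\<^sup>m H))\<^sup>-\<^sup>1\<close> are averages of the resolvent over roots of unity and
  therefore converge to an idempotent \<open>Q\<close>, whose transform at each character is the projection
  onto the stable subspace of the transformed Hamiltonian. This subspace is Lagrangian, and by
  stabilizability it is the graph of a Hermitian matrix, the solution of the Riccati equation at
  that character. The blocks of \<open>Q\<close> satisfy \<open>Q12\<^sup>* = Q12\<close> and \<open>Q11\<^sup>* = 1 - Q22\<close> at every character,
  so \<open>Q12 Q12 + Q11 (1 - Q22)\<close> is pointwise positive definite, hence invertible in the algebra, and
  this expresses the solution rationally in the blocks of \<open>Q\<close>. Semisimplicity turns pointwise
  identities into identities. The averages over roots of unity also replace the spectral radius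
  formula, both in the Gelfand--Mazur theorem and in the decay of the exponential.
\<close>

text \<open>The obstacle is uniformity. The Riccati equation can be solved at each character
  separately, but nothing forces the pointwise solutions to be transforms of one matrix over the
  algebra, or the pointwise decay rates to have a common bound. Both are settled inside the algebra,
  where a matrix is invertible as soon as none of its transforms has a kernel. Exponentiating moves
  the imaginary axis to the unit circle. For a scalar \<open>u\<close>, the inverse of
  \<open>1 - u ^ 2 ^ m\<close> tends to 1 if \<open>u\<close> lies inside the circle and to 0 if it
  lies outside, so the limit selects exactly the eigenvalues with negative real part. The involution
  need not satisfy \<open>\<phi> (star x) = cnj (\<phi> x)\<close>. Adjoints are therefore taken
  only at characters, and \<open>star\<close> enters only through the three expressions whose
  transforms the hypotheses describe. The formula for the solution is a pseudo-inverse: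
  \<open>[Q11, Q12]\<close> has full row rank at every character, and its adjoint times the inverse
  Gram matrix is a right inverse. Applying \<open>Q\<close> to it gives the pair
  \<open>(1, P)\<close>.\<close>

section \<open>Resolvents at roots of unity\<close>

text \<open>Allowing a seminorm covers quotients by ideals, with \<open>infdist\<close> as seminorm, without forming
  them; \<open>c\<close> is the embedding of the scalars.\<close>

locale seminormed_algebra =
  fixes q :: "'b::ring_1 \<Rightarrow> real" and c :: "complex \<Rightarrow> 'b"
  assumes q_add: "q (x + y) \<le> q x + q y"
    and q_mult: "q (x * y) \<le> q x * q y"
    and q_1: "q 1 \<le> 1"
    and q_scale: "q (c z * x) \<le> cmod z * q x"
    and c_add: "c (z + w) = c z + c w"
    and c_mult: "c (z * w) = c z * c w"
    and c_1: "c 1 = 1"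
    and c_commute: "c z * x = x * c z"
begin

lemma c_0: "c 0 = 0"
  using c_add[of 0 0] by simp

lemma c_minus: "c (- z) = - c z"
  using c_add[of z "- z"] c_0 by (simp add: eq_neg_iff_add_eq_0 add.commute)

lemma scale_power: "(c z * x) ^ k = c (z ^ k) * x ^ k"
proof (induction k)
  case (Suc k)
  have "(c z * x) ^ Suc k = c z * (x * c (z ^ k)) * x ^ k"
    by (simp add: Suc mult.assoc)
  also have "x * c (z ^ k) = c (z ^ k) * x"
    by (rule c_commute[symmetric])
  finally show ?case
    by (simp add: c_mult mult.assoc)
qed (simp add: c_1)

lemma q_0: "q 0 = 0"
  using q_scale[of 0 0] q_add[of 0 0] by (simp add: c_0)

lemma q_minus: "q (- x) = q x"
  using q_scale[of "-1" x] q_scale[of "-1" "-x"] by (simp add: c_minus c_1)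

lemma q_nonneg: "0 \<le> q x"
  using q_add[of x "-x"] by (simp add: q_0 q_minus)

lemma q_diff: "q (x - y) \<le> q x + q y"
  using q_add[of x "-y"] by (simp add: q_minus)

lemma q_power: "q (x ^ k) \<le> q x ^ k"
proof (induction k)
  case (Suc k)
  then show ?case
    using q_mult[of x "x ^ k"] mult_left_mono[OF Suc q_nonneg[of x]] by simp
qed (use q_1 in simp)

text \<open>When \<open>q\<close> is the distance to an ideal, its null space is the closure of that
  ideal; equations and inverses are taken modulo the null space.\<close>

definition eqv :: "'b \<Rightarrow> 'b \<Rightarrow> bool"  (infix "\<approx>\<^sub>q" 50)
  where "x \<approx>\<^sub>q y \<longleftrightarrow> q (x - y) = 0"

lemma eqv_refl [simp]: "x \<approx>\<^sub>q x"
  by (simp add: eqv_def q_0)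

lemma eqv_sym: "x \<approx>\<^sub>q y \<Longrightarrow> y \<approx>\<^sub>q x"
  using q_minus[of "x - y"] by (simp add: eqv_def)

lemma eqv_trans [trans]: "x \<approx>\<^sub>q y \<Longrightarrow> y \<approx>\<^sub>q z \<Longrightarrow> x \<approx>\<^sub>q z"
  using q_add[of "x - y" "y - z"] q_nonneg[of "x - z"] by (simp add: eqv_def)

lemma eqv_add: "x \<approx>\<^sub>q y \<Longrightarrow> x' \<approx>\<^sub>q y' \<Longrightarrow> x + x' \<approx>\<^sub>q y + y'"
  using q_add[of "x - y" "x' - y'"] q_nonneg[of "x + x' - (y + y')"]
  by (simp add: eqv_def algebra_simps)

lemma eqv_diff: "x \<approx>\<^sub>q y \<Longrightarrow> x' \<approx>\<^sub>q y' \<Longrightarrow> x - x' \<approx>\<^sub>q y - y'"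
  using q_diff[of "x - y" "x' - y'"] q_nonneg[of "x - x' - (y - y')"]
  by (simp add: eqv_def algebra_simps)

lemma eqv_mult_left: "x \<approx>\<^sub>q y \<Longrightarrow> u * x \<approx>\<^sub>q u * y"
  using q_mult[of u "x - y"] q_nonneg[of "u * x - u * y"] by (simp add: eqv_def right_diff_distrib)

lemma eqv_mult_right: "x \<approx>\<^sub>q y \<Longrightarrow> x * u \<approx>\<^sub>q y * u"
  using q_mult[of "x - y" u] q_nonneg[of "x * u - y * u"] by (simp add: eqv_def left_diff_distrib)

lemma q_cong: "x \<approx>\<^sub>q y \<Longrightarrow> q x = q y"
  using q_add[of "x - y" y] q_add[of "y - x" x] q_minus[of "x - y"] by (simp add: eqv_def)

lemma eqv_mult_bound: "x \<approx>\<^sub>q y * z \<Longrightarrow> q x \<le> q y * q z"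
  using q_cong q_mult[of y z] by simp

definition is_inverse :: "'b \<Rightarrow> 'b \<Rightarrow> bool"
  where "is_inverse x y \<longleftrightarrow> x * y \<approx>\<^sub>q 1 \<and> y * x \<approx>\<^sub>q 1"

text \<open>The middle factor is \<open>(1 - b) - (1 - a)\<close>, and each of its terms cancels
  against one of the inverses.\<close>

lemma resolvent_identity:
  assumes "is_inverse (1 - a) x" "is_inverse (1 - b) y"
  shows "x - y \<approx>\<^sub>q x * (a - b) * y"
proof -
  have "x * ((1 - b) * y) - x * (1 - a) * y \<approx>\<^sub>q x * 1 - 1 * y"
    using assms unfolding is_inverse_def
    by (intro eqv_diff eqv_mult_left eqv_mult_right) auto
  then have "x - y \<approx>\<^sub>q x * ((1 - b) * y) - x * (1 - a) * y"
    by (simp add: eqv_sym)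
  then show ?thesis
    by (simp add: algebra_simps)
qed

text \<open>Modulo the null space \<open>x - 1\<close> is \<open>x * a\<close>, so
  \<open>q (x - 1) \<le> (q (x - 1) + 1) / 16\<close>, which solves to
  \<open>1 / 15\<close>.\<close>

lemma inverse_near_one:
  assumes "is_inverse (1 - a) x" "q a \<le> 1 / 16"
  shows "q (x - 1) \<le> 1 / 15"
proof -
  have "is_inverse (1 - 0) 1"
    by (simp add: is_inverse_def)
  from resolvent_identity[OF assms(1) this] have "x - 1 \<approx>\<^sub>q x * a"
    by simp
  then have "q (x - 1) \<le> q x * q a"
    by (rule eqv_mult_bound)
  also have "\<dots> \<le> q x * (1 / 16)"
    using assms(2) q_nonneg by (intro mult_left_mono) auto
  also have "q x \<le> q (x - 1) + 1"
    using q_add[of "x - 1" 1] q_1 by simp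
  finally show ?thesis by simp
qed

text \<open>Modulo the null space \<open>a\<close> is \<open>(1 - a) * (x - 1)\<close>, so
  \<open>q a \<le> (1 + q a) / 3\<close>, which solves to \<open>1 / 2\<close>.\<close>

lemma near_one_inverse:
  assumes "is_inverse (1 - a) x" "q (x - 1) \<le> 1 / 3"
  shows "q a \<le> 1 / 2"
proof -
  have "(1 - a) * x - (1 - a) \<approx>\<^sub>q 1 - (1 - a)"
    using assms(1) by (intro eqv_diff) (auto simp: is_inverse_def)
  then have "(1 - a) * (x - 1) \<approx>\<^sub>q a"
    by (simp add: right_diff_distrib)
  then have "a \<approx>\<^sub>q (1 - a) * (x - 1)"
    by (rule eqv_sym)
  then have "q a \<le> q (1 - a) * q (x - 1)"
    by (rule eqv_mult_bound)
  also have "\<dots> \<le> (1 + q a) * (1 / 3)"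
    using q_diff[of 1 a] q_1 q_nonneg assms(2) by (intro mult_mono) auto
  finally show ?thesis by simp
qed

lemma inverse_bounded_on_compact:
  assumes "compact S" and inv: "\<And>z. z \<in> S \<Longrightarrow> is_inverse (1 - c z * U) (f z)"
  shows "\<exists>M\<ge>0. \<forall>z\<in>S. q (f z) \<le> M"
proof (rule ccontr)
  assume neg: "\<not> ?thesis"
  have "\<exists>z\<in>S. real k < q (f z)" for k :: nat
    using neg by (meson not_le of_nat_0_le_iff)
  then obtain s where s: "\<And>k. s k \<in> S" "\<And>k. real k < q (f (s k))"
    by metis
  obtain l r where l: "l \<in> S" "strict_mono r" "(s \<circ> r) \<longlonglongrightarrow> l"
    using \<open>compact S\<close> s(1) unfolding compact_def by metis
  define M where "M = q (f l)"
  have "(\<lambda>k. cmod ((s \<circ> r) k - l) * q U * M) \<longlonglongrightarrow> cmod (l - l) * q U * M"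
    by (intro tendsto_intros l(3))
  then have "eventually (\<lambda>k. cmod (s (r k) - l) * q U * M < 1 / 2) sequentially"
    by (auto dest!: order_tendstoD(2)[where a = "1 / 2"])
  moreover obtain K :: nat where "2 * M < real K"
    using reals_Archimedean2 by blast
  then have "eventually (\<lambda>k. 2 * M < real k) sequentially"
    by (intro eventually_sequentiallyI[of K]) auto
  ultimately have "eventually (\<lambda>k. cmod (s (r k) - l) * q U * M < 1 / 2 \<and> 2 * M < real k) sequentially"
    by eventually_elim auto
  then obtain k where k: "cmod (s (r k) - l) * q U * M < 1 / 2" "2 * M < real k"
    using eventually_happens by fastforce
  define z where "z = s (r k)"
  have "z \<in> S" by (simp add: z_def s)
  have "c z * U - c l * U = c (z - l) * U"
    using c_add[of "z - l" l] by (simp add: algebra_simps)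
  then have "f z - f l \<approx>\<^sub>q f z * (c (z - l) * U) * f l"
    using resolvent_identity[OF inv[OF \<open>z \<in> S\<close>] inv[OF l(1)]] by simp
  then have "q (f z - f l) \<le> q (f z * (c (z - l) * U)) * M"
    unfolding M_def by (rule eqv_mult_bound)
  also have "\<dots> \<le> (q (f z) * (cmod (z - l) * q U)) * M"
    by (intro mult_right_mono order_trans[OF q_mult] mult_left_mono q_scale) (auto simp: M_def q_nonneg)
  also have "\<dots> = q (f z) * (cmod (z - l) * q U * M)"
    by simp
  also have "\<dots> \<le> q (f z) * (1 / 2)"
    using k(1) by (intro mult_left_mono) (auto simp: z_def q_nonneg)
  finally have "q (f z) \<le> 2 * M"
    using q_add[of "f z - f l" "f l"] by (simp add: M_def)
  moreover have "real k \<le> real (r k)"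
    using seq_suble[OF l(2)] by simp
  ultimately show False
    using s(2)[of "r k"] k(2) by (simp add: z_def)
qed

lemma inverse_Lipschitz_on_compact:
  assumes "compact S" and inv: "\<And>z. z \<in> S \<Longrightarrow> is_inverse (1 - c z * U) (f z)"
  shows "\<exists>L\<ge>0. \<forall>z\<in>S. \<forall>w\<in>S. q (f z - f w) \<le> L * cmod (z - w)"
proof -
  obtain M where M: "M \<ge> 0" "\<And>z. z \<in> S \<Longrightarrow> q (f z) \<le> M"
    using inverse_bounded_on_compact[OF assms] by blast
  have "q (f z - f w) \<le> (M * q U * M) * cmod (z - w)" if "z \<in> S" "w \<in> S" for z w
  proof -
    have "c z * U - c w * U = c (z - w) * U"
      using c_add[of "z - w" w] by (simp add: algebra_simps)
    then have "f z - f w \<approx>\<^sub>q f z * (c (z - w) * U) * f w"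
      using resolvent_identity[OF inv[OF that(1)] inv[OF that(2)]] by simp
    then have "q (f z - f w) \<le> q (f z * (c (z - w) * U)) * q (f w)"
      by (rule eqv_mult_bound)
    also have "\<dots> \<le> (M * (cmod (z - w) * q U)) * M"
      using M that
      by (intro mult_mono order_trans[OF q_mult] q_scale) (auto simp: q_nonneg)
    finally show ?thesis by (simp add: mult_ac)
  qed
  then show ?thesis
    using M(1) q_nonneg by (intro exI[of _ "M * q U * M"]) auto
qed

text \<open>The mean of \<open>f\<close> over the points \<open>w z\<close> with \<open>w ^ 2 ^ m = 1\<close>.\<close>

primrec root_average :: "(complex \<Rightarrow> 'b) \<Rightarrow> nat \<Rightarrow> complex \<Rightarrow> 'b" where
  "root_average f 0 z = f z"
| "root_average f (Suc m) z =
     c (1 / 2) * (root_average f m z + root_average f m (cis (pi / 2 ^ m) * z))"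

lemma root_average_rotate: "root_average (\<lambda>z. f (w * z)) m z = root_average f m (w * z)"
  by (induction m arbitrary: z) (simp_all add: mult_ac)

lemma half_sum_bound:
  assumes "q x \<le> d" "q y \<le> d"
  shows "q (c (1 / 2) * (x + y)) \<le> d"
  using q_scale[of "1 / 2" "x + y"] q_add[of x y] assms by simp

lemma root_average_diff:
  assumes "\<And>z. cmod z = 1 \<Longrightarrow> q (f z - g z) \<le> d" "cmod z = 1"
  shows "q (root_average f m z - root_average g m z) \<le> d"
  using assms(2)
proof (induction m arbitrary: z)
  case (Suc m)
  let ?w = "cis (pi / 2 ^ m) * z"
  have "q (c (1 / 2) * ((root_average f m z - root_average g m z)
      + (root_average f m ?w - root_average g m ?w))) \<le> d"
    using Suc.prems by (intro half_sum_bound Suc.IH) (simp_all add: norm_mult)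
  then show ?case
    by (simp add: algebra_simps)
qed (use assms(1) in simp)

text \<open>Partial fractions: half the sum of the inverses of \<open>1 - a\<close> and
  \<open>1 + a\<close> inverts \<open>1 - a * a\<close>, so each averaging step doubles the
  exponent.\<close>

lemma root_average_inverse:
  assumes "\<And>z. cmod z = 1 \<Longrightarrow> is_inverse (1 - c z * U) (f z)" "cmod z = 1"
  shows "is_inverse (1 - c (z ^ 2 ^ m) * U ^ 2 ^ m) (root_average f m z)"
  using assms(2)
proof (induction m arbitrary: z)
  case (Suc m)
  define a where "a = c (z ^ 2 ^ m) * U ^ 2 ^ m"
  define w where "w = cis (pi / 2 ^ m) * z"
  define x y where "x = root_average f m z" and "y = root_average f m w"
  have x: "is_inverse (1 - a) x"
    using Suc by (simp add: a_def x_def)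
  \<comment> \<open>The rotation is a primitive root of order \<open>2 ^ (m + 1)\<close>; it flips
    the sign of the \<open>2 ^ m\<close>-th power and thus leads to the inverse of
    \<open>1 + a\<close>.\<close>
  have "cis (pi / 2 ^ m) ^ 2 ^ m = - 1"
    using Complex.DeMoivre[of "pi / 2 ^ m" "2 ^ m"] by simp
  then have "w ^ 2 ^ m = - (z ^ 2 ^ m)"
    by (simp add: w_def power_mult_distrib)
  then have "is_inverse (1 + a) y"
    using Suc.IH[of w] Suc.prems by (simp add: a_def y_def w_def norm_mult c_minus)
  note xy = x this
  have a2: "c (z ^ 2 ^ Suc m) * U ^ 2 ^ Suc m = a * a"
  proof -
    have "a * a = (c (z ^ 2 ^ m) * U ^ 2 ^ m) ^ 2"
      by (simp add: a_def power2_eq_square)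
    also have "\<dots> = c ((z ^ 2 ^ m) ^ 2) * (U ^ 2 ^ m) ^ 2"
      by (rule scale_power)
    finally show ?thesis
      by (simp add: power_mult[symmetric] mult.commute)
  qed
  have half: "c (1 / 2) * (1 + 1) = 1"
    using c_add[of "1 / 2" "1 / 2"] by (simp add: c_1 distrib_left del: one_add_one)
  have "(1 + a) * ((1 - a) * x) + (1 - a) * ((1 + a) * y) \<approx>\<^sub>q (1 + a) * 1 + (1 - a) * 1"
    using xy by (intro eqv_add eqv_mult_left) (auto simp: is_inverse_def)
  then have "(1 - a * a) * (x + y) \<approx>\<^sub>q 1 + 1"
    by (simp add: algebra_simps)
  then have "c (1 / 2) * ((1 - a * a) * (x + y)) \<approx>\<^sub>q 1"
    using eqv_mult_left[of _ "1 + 1" "c (1 / 2)"] unfolding half by blast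
  moreover have "c (1 / 2) * ((1 - a * a) * (x + y)) = (1 - a * a) * (c (1 / 2) * (x + y))"
    unfolding mult.assoc[symmetric] c_commute[of "1 / 2" "1 - a * a"] ..
  ultimately have l: "(1 - a * a) * (c (1 / 2) * (x + y)) \<approx>\<^sub>q 1"
    by simp
  have "(x * (1 - a)) * (1 + a) + (y * (1 + a)) * (1 - a) \<approx>\<^sub>q 1 * (1 + a) + 1 * (1 - a)"
    using xy by (intro eqv_add eqv_mult_right) (auto simp: is_inverse_def)
  then have "(x + y) * (1 - a * a) \<approx>\<^sub>q 1 + 1"
    by (simp add: algebra_simps)
  then have "c (1 / 2) * (x + y) * (1 - a * a) \<approx>\<^sub>q 1"
    using eqv_mult_left[of _ "1 + 1" "c (1 / 2)"] unfolding half mult.assoc by blast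
  with l show ?case
    by (simp only: a2 is_inverse_def root_average.simps x_def y_def w_def)
qed (use assms(1) in simp)

text \<open>Rescaling \<open>U\<close> by \<open>k / n\<close>, smallness of the powers passes from \<open>k\<close> to \<open>k + 1\<close>, because the
  averages of the two resolvents differ by at most \<open>1 / 5\<close> uniformly in \<open>m\<close>.\<close>

lemma power_seminorm_less_1:
  assumes inv: "\<And>z. cmod z \<le> 1 \<Longrightarrow> is_inverse (1 - c z * U) (f z)"
  shows "\<exists>m. q (U ^ 2 ^ m) \<le> 1 / 2"
proof -
  obtain L where L: "L \<ge> 0" "\<And>z w. cmod z \<le> 1 \<Longrightarrow> cmod w \<le> 1 \<Longrightarrow> q (f z - f w) \<le> L * cmod (z - w)"
    using inverse_Lipschitz_on_compact[of "cball 0 1" U f] inv by (force simp: dist_norm)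
  \<comment> \<open>With \<open>n > 5 * L\<close> one rescaling step moves the resolvent by at most
    \<open>1 / 5\<close>.\<close>
  obtain n :: nat where n: "5 * L < real n"
    using reals_Archimedean2 by blast
  then have "n > 0" using L(1) by (cases n) auto
  define V where "V k = c (complex_of_real (real k / real n)) * U" for k
  define g where "g k z = f (complex_of_real (real k / real n) * z)" for k z
  have V: "is_inverse (1 - c z * V k) (g k z)" if "cmod z = 1" "k \<le> n" for z k
  proof -
    have "c z * V k = c (complex_of_real (real k / real n) * z) * U"
      unfolding V_def mult.assoc[symmetric] c_mult[symmetric] by (simp only: mult.commute)
    moreover have "cmod (complex_of_real (real k / real n) * z) \<le> 1"
      using that by (simp add: norm_mult norm_divide divide_simps)
    ultimately show ?thesis
      using inv by (simp add: g_def)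
  qed
  have "\<exists>m. q (V k ^ 2 ^ m) \<le> 1 / 2" if "k \<le> n" for k
    using that
  proof (induction k)
    case 0
    have "V 0 ^ 2 ^ 0 = 0" by (simp add: V_def c_0)
    then have "q (V 0 ^ 2 ^ 0) \<le> 1 / 2" by (simp only: q_0)
    then show ?case ..
  next
    case (Suc k)
    then obtain m where m: "q (V k ^ 2 ^ m) \<le> 1 / 2" by auto
    \<comment> \<open>Two more squarings turn \<open>1 / 2\<close> into \<open>1 / 16\<close>; then
      \<open>1 / 15 + 1 / 5 \<le> 1 / 3\<close> leads back to \<open>1 / 2\<close> for the next
      \<open>k\<close>.\<close>
    define j where "j = m + 2"
    have "q (V k ^ 2 ^ j) = q ((V k ^ 2 ^ m) ^ 4)"
      unfolding j_def power_add power_mult by simp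
    also have "\<dots> \<le> q (V k ^ 2 ^ m) ^ 4" by (rule q_power)
    also have "\<dots> \<le> (1 / 2) ^ 4" using m q_nonneg by (intro power_mono)
    finally have *: "q (V k ^ 2 ^ j) \<le> 1 / 16" by (simp add: power4_eq_xxxx)
    define x y where "x = root_average (g k) j 1" and "y = root_average (g (Suc k)) j 1"
    have x: "is_inverse (1 - V k ^ 2 ^ j) x" and y: "is_inverse (1 - V (Suc k) ^ 2 ^ j) y"
      using root_average_inverse[of "V k" "g k" 1 j] root_average_inverse[of "V (Suc k)" "g (Suc k)" 1 j]
        V Suc.prems by (simp_all add: x_def y_def c_1)
    have "q (g k z - g (Suc k) z) \<le> 1 / 5" if "cmod z = 1" for z
    proof -
      have "complex_of_real (real k / real n) * z - complex_of_real (real (Suc k) / real n) * z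
          = - (z / complex_of_real (real n))"
        by (simp add: algebra_simps add_divide_distrib)
      then have eq: "cmod (complex_of_real (real k / real n) * z - complex_of_real (real (Suc k) / real n) * z) = 1 / real n"
        using that by (simp add: norm_divide)
      have "q (g k z - g (Suc k) z) \<le> L * (1 / real n)"
        unfolding g_def eq[symmetric]
        using that Suc.prems \<open>n > 0\<close> by (intro L(2)) (simp_all add: norm_mult norm_divide divide_simps del: of_nat_Suc)
      also have "\<dots> \<le> 1 / 5" using n \<open>n > 0\<close> by (simp add: field_simps)
      finally show ?thesis .
    qed
    then have "q (x - y) \<le> 1 / 5"
      unfolding x_def y_def by (intro root_average_diff) auto
    then have "q (y - x) \<le> 1 / 5"
      using q_minus[of "x - y"] by simp
    then have "q (y - 1) \<le> 1 / 3"
      using q_add[of "y - x" "x - 1"] inverse_near_one[OF x *] by simp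
    then show ?case
      using near_one_inverse[OF y] by blast
  qed
  from this[OF order_refl] obtain m where m: "q (V n ^ 2 ^ m) \<le> 1 / 2" ..
  have "complex_of_real (real n / real n) = 1"
    using \<open>n > 0\<close> by simp
  then have "V n = U"
    unfolding V_def by (simp only: c_1 mult_1)
  from m[unfolded this] show ?thesis ..
qed

end

section \<open>Spectral idempotents and Gelfand theory\<close>

text \<open>The \<open>s m\<close> are Riemann sums of the resolvent over the unit circle, and
  \<open>Q\<close> is the Riesz projection for the part of the spectrum of \<open>U\<close> inside
  it.\<close>

lemma spectral_idempotent:
  fixes U :: "'b::{real_normed_algebra_1, banach}"
  assumes "seminormed_algebra (norm :: 'b \<Rightarrow> real) c"
    and inv: "\<And>z. cmod z = 1 \<Longrightarrow> \<exists>y. (1 - c z * U) * y = 1 \<and> y * (1 - c z * U) = 1"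
  shows "\<exists>Q s. s \<longlonglongrightarrow> Q \<and> Q * Q = Q \<and>
    (\<forall>m. (1 - U ^ 2 ^ m) * s m = 1 \<and> s m * (1 - U ^ 2 ^ m) = 1)"
proof -
  interpret seminormed_algebra "norm :: 'b \<Rightarrow> real" c by fact
  have is_inverse: "is_inverse x y \<longleftrightarrow> x * y = 1 \<and> y * x = 1" for x y
    by (simp add: is_inverse_def eqv_def)
  obtain f where f: "\<And>z. cmod z = 1 \<Longrightarrow> is_inverse (1 - c z * U) (f z)"
    using inv unfolding is_inverse by metis
  obtain L where L: "L \<ge> 0" "\<And>z w. cmod z = 1 \<Longrightarrow> cmod w = 1 \<Longrightarrow> norm (f z - f w) \<le> L * cmod (z - w)"
    using inverse_Lipschitz_on_compact[of "sphere 0 1" U f] f by (force simp: dist_norm)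
  define \<zeta> where "\<zeta> m = cis (pi / 2 ^ m)" for m :: nat
  define s where "s m = root_average f m 1" for m
  \<comment> \<open>These sample points lie halfway between those of \<open>s m\<close>; since
    \<open>\<zeta> m ^ 2 ^ m = - 1\<close>, the average inverts
    \<open>1 + U ^ 2 ^ m\<close>.\<close>
  define t where "t m = root_average f m (\<zeta> m)" for m
  have \<zeta>: "cmod (\<zeta> m) = 1" "\<zeta> m ^ 2 ^ m = - 1" for m
    using Complex.DeMoivre[of "pi / 2 ^ m" "2 ^ m"] by (simp_all add: \<zeta>_def)
  have s_inv: "is_inverse (1 - U ^ 2 ^ m) (s m)" and t_inv: "is_inverse (1 + U ^ 2 ^ m) (t m)" for m
    using root_average_inverse[OF f, of 1 m] root_average_inverse[OF f \<zeta>(1), of m m]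
    by (simp_all add: s_def t_def \<zeta>(2) c_1 c_minus)
  have s_Suc: "s (Suc m) = c (1 / 2) * (s m + t m)" for m
    by (simp add: s_def t_def \<zeta>_def)
  have dist_\<zeta>: "cmod (1 - \<zeta> m) \<le> pi * (1 / 2) ^ m" for m
  proof -
    have "cmod (1 - \<zeta> m) = cmod (exp (\<i> * of_real (pi / 2 ^ m)) - 1)"
      by (simp add: \<zeta>_def cis_conv_exp norm_minus_commute)
    also have "\<dots> = 2 * \<bar>sin (pi / 2 ^ m / 2)\<bar>"
      by (rule dist_exp_i_1)
    also have "\<dots> \<le> 2 * \<bar>pi / 2 ^ m / 2\<bar>"
      by (intro mult_left_mono abs_sin_x_le_abs_x) auto
    finally show ?thesis by (simp add: power_one_over)
  qed
  have st: "norm (s m - t m) \<le> L * pi * (1 / 2) ^ m" for m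
  proof -
    have "norm (root_average f m 1 - root_average (\<lambda>z. f (\<zeta> m * z)) m 1) \<le> L * cmod (1 - \<zeta> m)"
    proof (rule root_average_diff)
      fix z :: complex assume z: "cmod z = 1"
      then have "norm (f z - f (\<zeta> m * z)) \<le> L * cmod (z - \<zeta> m * z)"
        by (intro L(2)) (simp_all add: norm_mult \<zeta>)
      also have "z - \<zeta> m * z = (1 - \<zeta> m) * z" by (simp add: algebra_simps)
      finally show "norm (f z - f (\<zeta> m * z)) \<le> L * cmod (1 - \<zeta> m)"
        using z by (simp add: norm_mult)
    qed simp
    also have "\<dots> \<le> L * (pi * (1 / 2) ^ m)"
      by (intro mult_left_mono dist_\<zeta> L(1))
    finally show ?thesis
      by (simp add: root_average_rotate s_def t_def mult.assoc)
  qed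
  have half: "c (1 / 2) * (x + x) = x" for x
  proof -
    have "c (1 / 2) * (x + x) = (c (1 / 2) + c (1 / 2)) * x"
      by (simp only: distrib_left distrib_right)
    also have "c (1 / 2) + c (1 / 2) = 1"
      using c_add[of "1 / 2" "1 / 2"] by (simp add: c_1)
    finally show ?thesis by simp
  qed
  have "summable (\<lambda>m. s (Suc m) - s m)"
  proof (rule summable_comparison_test')
    show "summable (\<lambda>m. (L * pi) * (1 / 2) ^ m :: real)"
      by (intro summable_mult summable_geometric) auto
    show "norm (s (Suc m) - s m) \<le> L * pi * (1 / 2) ^ m" if "0 \<le> m" for m
    proof -
      have "s (Suc m) - s m = c (1 / 2) * (s m + t m) - c (1 / 2) * (s m + s m)"
        by (simp only: half s_Suc)
      also have "\<dots> = c (1 / 2) * (0 + (t m - s m))"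
        by (simp add: algebra_simps)
      finally show ?thesis
        using half_sum_bound[of 0 "L * pi * (1 / 2) ^ m" "t m - s m"] st[of m] L(1)
        by (simp add: norm_minus_commute)
    qed
  qed
  then have "convergent (\<lambda>m. s m - s 0)"
    by (simp add: summable_iff_convergent sum_lessThan_telescope)
  then have "convergent s"
    using convergent_add[OF _ convergent_const[of "s 0"]] by fastforce
  then obtain Q where s: "s \<longlonglongrightarrow> Q" by (auto simp: convergent_def)
  have "(\<lambda>m. s m - t m) \<longlonglongrightarrow> 0"
  proof (rule Lim_null_comparison)
    show "eventually (\<lambda>m. norm (s m - t m) \<le> L * pi * (1 / 2) ^ m) sequentially"
      by (intro always_eventually allI st)
    show "(\<lambda>m. L * pi * (1 / 2) ^ m) \<longlonglongrightarrow> 0"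
      by (intro tendsto_mult_right_zero LIMSEQ_power_zero) auto
  qed
  from tendsto_diff[OF s this] have t: "t \<longlonglongrightarrow> Q" by simp
  \<comment> \<open>With \<open>b = U ^ 2 ^ m\<close>, multiply \<open>2 = (1 + b) + (1 - b)\<close>
    by \<open>s m\<close> on the left and by \<open>t m\<close> on the right. In the limit both
    factors become \<open>Q\<close>, which gives idempotency.\<close>
  have "s m + t m = s m * t m + s m * t m" for m
  proof -
    have "s m = s m * ((1 + U ^ 2 ^ m) * t m)" "t m = (s m * (1 - U ^ 2 ^ m)) * t m"
      using s_inv[of m] t_inv[of m] by (simp_all add: is_inverse)
    then have "s m + t m = s m * ((1 + U ^ 2 ^ m) * t m) + (s m * (1 - U ^ 2 ^ m)) * t m"
      by simp
    also have "\<dots> = s m * t m + s m * t m"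
      by (simp add: algebra_simps)
    finally show ?thesis .
  qed
  moreover have "(\<lambda>m. s m + t m) \<longlonglongrightarrow> Q + Q" "(\<lambda>m. s m * t m + s m * t m) \<longlonglongrightarrow> Q * Q + Q * Q"
    by (intro tendsto_intros s t)+
  ultimately have "Q + Q = Q * Q + Q * Q"
    using LIMSEQ_unique by auto
  then have "Q * Q = Q"
    using half by metis
  with s s_inv show ?thesis
    unfolding is_inverse by blast
qed

section \<open>Maximal ideals, quotient seminorms and characters\<close>

lemma scaleC_1: "1 *\<^sub>C x = (x :: 'a::comm_complex_banach_algebra_1)"
  using scaleC_of_real[of 1 x] by simp

lemma seminormed_algebra_norm_scaleC:
  "seminormed_algebra (norm :: 'a::comm_complex_banach_algebra_1 \<Rightarrow> real) (\<lambda>z. z *\<^sub>C 1)"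
proof
  fix z w :: complex and x y :: 'a
  show "norm (x + y) \<le> norm x + norm y" by (rule norm_triangle_ineq)
  show "norm (x * y) \<le> norm x * norm y" by (rule norm_mult_ineq)
  show "norm ((z *\<^sub>C 1) * x) \<le> cmod z * norm x"
    by (simp add: mult_scaleC_left norm_scaleC)
  show "z *\<^sub>C 1 * x = x * z *\<^sub>C 1"
    by (rule mult.commute)
  show "(z * w) *\<^sub>C 1 = (z *\<^sub>C (1::'a)) * (w *\<^sub>C 1)"
    by (simp add: mult_scaleC_left scaleC_scaleC)
qed (simp_all add: scaleC_1 scaleC_add_left)

text \<open>Ideals as plain sets, because the carrier of \<open>ring_of_type_algebra\<close> is the
  whole type; \<open>maximalideal_iff_type_maximal_ideal\<close> links them to
  \<open>semisimple\<close>.\<close>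

definition type_ideal :: "'a::comm_ring_1 set \<Rightarrow> bool" where
  "type_ideal I \<longleftrightarrow> 0 \<in> I \<and> (\<forall>x\<in>I. \<forall>y\<in>I. x + y \<in> I) \<and> (\<forall>x. \<forall>y\<in>I. x * y \<in> I)"

definition type_maximal_ideal :: "'a::comm_ring_1 set \<Rightarrow> bool" where
  "type_maximal_ideal I \<longleftrightarrow>
     type_ideal I \<and> I \<noteq> UNIV \<and> (\<forall>J. type_ideal J \<longrightarrow> I \<subseteq> J \<longrightarrow> J = I \<or> J = UNIV)"

lemma type_ideal_minus: "type_ideal I \<Longrightarrow> x \<in> I \<Longrightarrow> - x \<in> I"
  unfolding type_ideal_def by (metis mult_minus1)

lemma ideal_iff_type_ideal:
  "ideal I (ring_of_type_algebra :: 'a::comm_ring_1 ring) \<longleftrightarrow> type_ideal I"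
proof
  assume "ideal I (ring_of_type_algebra :: 'a ring)"
  then interpret ideal I "ring_of_type_algebra :: 'a ring" .
  show "type_ideal I"
    using additive_subgroup.zero_closed[OF is_additive_subgroup]
      additive_subgroup.a_closed[OF is_additive_subgroup] I_l_closed
    unfolding type_ideal_def ring_of_type_algebra_def by auto
next
  assume I: "type_ideal I"
  interpret R: ring "ring_of_type_algebra :: 'a ring" by (rule ring_from_type_algebra)
  have inv: "inv\<^bsub>add_monoid (ring_of_type_algebra :: 'a ring)\<^esub> x = - x" for x
    unfolding a_inv_def[symmetric]
    by (rule R.minus_equality) (auto simp: ring_of_type_algebra_def)
  show "ideal I (ring_of_type_algebra :: 'a ring)"
  proof (rule idealI)
    show "subgroup I (add_monoid (ring_of_type_algebra :: 'a ring))"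
      using I type_ideal_minus[OF I] inv unfolding type_ideal_def
      by (intro subgroup.intro) (auto simp: ring_of_type_algebra_def)
  next
    have "x * a \<in> I" "a * x \<in> I" if "a \<in> I" for a x
      using I that unfolding mult.commute[of a x] by (simp_all add: type_ideal_def)
    then show "x \<otimes>\<^bsub>ring_of_type_algebra\<^esub> a \<in> I" "a \<otimes>\<^bsub>ring_of_type_algebra\<^esub> x \<in> I"
      if "a \<in> I" for a x
      using that by (simp_all add: ring_of_type_algebra_def)
  qed (rule ring_from_type_algebra)
qed

lemma maximalideal_iff_type_maximal_ideal:
  "maximalideal I (ring_of_type_algebra :: 'a::comm_ring_1 ring) \<longleftrightarrow> type_maximal_ideal I"
  unfolding maximalideal_def maximalideal_axioms_def type_maximal_ideal_def ideal_iff_type_ideal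
  by (auto simp: ring_of_type_algebra_def)

text \<open>The ideal generated by \<open>I\<close> and \<open>x\<close> is everything by
  maximality, hence contains 1.\<close>

lemma type_maximal_ideal_coprime:
  assumes I: "type_maximal_ideal I" and "x \<notin> I"
  shows "\<exists>a. a * x - 1 \<in> I"
proof -
  have idl: "type_ideal I" using I by (simp add: type_maximal_ideal_def)
  define J where "J = {a * x + i |a i. i \<in> I}"
  have "type_ideal J"
    unfolding type_ideal_def
  proof (intro conjI ballI allI)
    show "0 \<in> J" using idl unfolding J_def type_ideal_def by (auto intro!: exI[of _ 0])
  next
    fix u v assume "u \<in> J" "v \<in> J"
    then obtain a i b j where "u = a * x + i" "v = b * x + j" "i \<in> I" "j \<in> I"
      by (auto simp: J_def)
    then have "u + v = (a + b) * x + (i + j)" "i + j \<in> I"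
      using idl by (auto simp: algebra_simps type_ideal_def)
    then show "u + v \<in> J" by (auto simp: J_def)
  next
    fix w u assume "u \<in> J"
    then obtain a i where "u = a * x + i" "i \<in> I"
      by (auto simp: J_def)
    then have "w * u = (w * a) * x + (w * i)" "w * i \<in> I"
      using idl by (simp_all add: distrib_left mult.assoc type_ideal_def)
    then show "w * u \<in> J" by (auto simp: J_def)
  qed
  moreover have "I \<subseteq> J"
  proof
    fix i assume "i \<in> I"
    then have "i = 0 * x + i \<and> i \<in> I" by simp
    then show "i \<in> J" unfolding J_def by blast
  qed
  moreover have "x \<in> J"
  proof -
    have "x = 1 * x + 0 \<and> 0 \<in> I" using idl by (simp add: type_ideal_def)
    then show ?thesis unfolding J_def by blast
  qed
  ultimately have "J = UNIV"
    using I \<open>x \<notin> I\<close> unfolding type_maximal_ideal_def by blast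
  then obtain a i where "1 = a * x + i" "i \<in> I"
    unfolding J_def by blast
  then have "a * x - 1 = - i" by (simp add: algebra_simps)
  then show ?thesis
    using type_ideal_minus[OF idl \<open>i \<in> I\<close>] by metis
qed

text \<open>Zorn's lemma for the ideals that contain \<open>x\<close> but not 1: the principal ideal
  of \<open>x\<close> is one of them, and avoiding 1 survives unions of chains.\<close>

lemma non_unit_in_type_maximal_ideal:
  fixes x :: "'a::comm_ring_1"
  assumes "\<nexists>y. y * x = 1"
  shows "\<exists>I. type_maximal_ideal I \<and> x \<in> I"
proof -
  define F where "F = {I. type_ideal I \<and> x \<in> I \<and> 1 \<notin> I}"
  have "range (\<lambda>a. a * x) \<in> F"
  proof -
    have "a * x + b * x \<in> range (\<lambda>a. a * x)" "a * (b * x) \<in> range (\<lambda>a. a * x)" for a b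
      by (metis distrib_right rangeI) (metis mult.assoc rangeI)
    moreover have "0 \<in> range (\<lambda>a. a * x)" "x \<in> range (\<lambda>a. a * x)"
      by (metis mult_zero_left rangeI) (metis mult_1_left rangeI)
    moreover have "1 \<notin> range (\<lambda>a. a * x)"
      using assms by (metis imageE)
    ultimately show ?thesis
      by (auto simp: F_def type_ideal_def)
  qed
  then have "\<exists>M\<in>F. \<forall>K\<in>F. M \<subseteq> K \<longrightarrow> K = M"
  proof (intro subset_Zorn_nonempty)
    fix C assume C: "C \<noteq> {}" "subset.chain F C"
    then have CF: "\<And>I. I \<in> C \<Longrightarrow> type_ideal I \<and> x \<in> I \<and> 1 \<notin> I"
      by (auto simp: subset.chain_def F_def)
    have "u + v \<in> \<Union>C" if uv: "u \<in> \<Union>C" "v \<in> \<Union>C" for u v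
    proof -
      obtain I J where IJ: "I \<in> C" "u \<in> I" "J \<in> C" "v \<in> J" using uv by auto
      then have "I \<subseteq> J \<or> J \<subseteq> I"
        using C(2) by (auto simp: subset_chain_def)
      then obtain K where "K \<in> C" "u \<in> K" "v \<in> K" using IJ by blast
      then show ?thesis using CF unfolding type_ideal_def by blast
    qed
    moreover have "0 \<in> \<Union>C" "x \<in> \<Union>C" "1 \<notin> \<Union>C" "\<And>w u. u \<in> \<Union>C \<Longrightarrow> w * u \<in> \<Union>C"
      using C(1) CF unfolding type_ideal_def by blast+
    ultimately show "\<Union>C \<in> F"
      unfolding F_def type_ideal_def by blast
  qed auto
  then obtain M where M: "type_ideal M" "x \<in> M" "1 \<notin> M" "\<And>K. K \<in> F \<Longrightarrow> M \<subseteq> K \<Longrightarrow> K = M"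
    unfolding F_def by blast
  have "J = M \<or> J = UNIV" if J: "type_ideal J" "M \<subseteq> J" for J
  proof (cases "1 \<in> J")
    case True
    then have "w \<in> J" for w
      using J(1) unfolding type_ideal_def by (metis mult_1_right)
    then show ?thesis by blast
  next
    case False
    then show ?thesis using M J unfolding F_def by blast
  qed
  then have "type_maximal_ideal M"
    using M unfolding type_maximal_ideal_def by auto
  then show ?thesis using M(2) by blast
qed

lemma unit_near_one:
  fixes x :: "'a::{real_normed_algebra_1, banach}"
  assumes "norm x < 1"
  shows "\<exists>y. y * (1 - x) = 1"
proof -
  have "summable (\<lambda>n. norm (x ^ n))"
    by (rule summable_comparison_test'[where g = "\<lambda>n. norm x ^ n" and N = 0])
      (use assms in \<open>auto intro: norm_power_ineq\<close>)
  then have s: "summable (\<lambda>n. x ^ n)" by (rule summable_norm_cancel)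
  have "(\<Sum>n. x ^ n) * x = (\<Sum>n. x ^ n * x)"
    using suminf_mult2[OF s] by simp
  also have "\<dots> = (\<Sum>n. x ^ Suc n)"
    by (simp add: power_commutes)
  also have "\<dots> = (\<Sum>n. x ^ n) - 1"
    using suminf_split_initial_segment[OF s, of 1] by simp
  finally have "(\<Sum>n. x ^ n) * (1 - x) = 1"
    by (simp add: right_diff_distrib)
  then show ?thesis ..
qed

lemma infdist_less_iff:
  assumes "A \<noteq> {}"
  shows "infdist x A < r \<longleftrightarrow> (\<exists>a\<in>A. dist x a < r)"
  unfolding infdist_notempty[OF assms]
  by (rule cINF_less_iff[OF assms]) (auto intro: bdd_belowI[of _ 0])

text \<open>This is the quotient seminorm. The infimum need not be attained, so the estimates are
  proved with some slack, which then tends to 0.\<close>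

lemma seminormed_algebra_infdist:
  fixes I :: "'a::comm_complex_banach_algebra_1 set"
  assumes I: "type_ideal I"
  shows "seminormed_algebra (\<lambda>x. infdist x I) (\<lambda>z. z *\<^sub>C 1)"
proof -
  interpret N: seminormed_algebra "norm :: 'a \<Rightarrow> real" "\<lambda>z. z *\<^sub>C 1"
    by (rule seminormed_algebra_norm_scaleC)
  have ne: "I \<noteq> {}" using I by (auto simp: type_ideal_def)
  have I0: "0 \<in> I" and I_add: "\<And>x y. x \<in> I \<Longrightarrow> y \<in> I \<Longrightarrow> x + y \<in> I"
    and I_mult: "\<And>x y. y \<in> I \<Longrightarrow> x * y \<in> I"
    using I by (auto simp: type_ideal_def)
  have I_scale: "z *\<^sub>C x \<in> I" if "x \<in> I" for z x
    using I_mult[OF that, of "z *\<^sub>C 1"] by (simp add: mult_scaleC_left)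
  show ?thesis
  proof
    fix x y :: 'a and z :: complex
    show "infdist (x + y) I \<le> infdist x I + infdist y I"
    proof (rule field_le_epsilon)
      fix e :: real assume "e > 0"
      then have "infdist x I < infdist x I + e / 2" "infdist y I < infdist y I + e / 2" by auto
      then obtain i j where ij: "i \<in> I" "dist x i < infdist x I + e / 2" "j \<in> I" "dist y j < infdist y I + e / 2"
        unfolding infdist_less_iff[OF ne] by blast
      have "dist (x + y) (i + j) \<le> dist x i + dist y j" by (rule dist_triangle_add)
      then show "infdist (x + y) I \<le> infdist x I + infdist y I + e"
        using infdist_le2[OF I_add[OF ij(1,3)], of "x + y"] ij by fastforce
    qed
    have mult: "infdist (x * y) I \<le> u * v" if uv: "infdist x I < u" "infdist y I < v" for u v
    proof -
      obtain i j where ij: "i \<in> I" "norm (x - i) < u" "j \<in> I" "norm (y - j) < v"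
        using uv unfolding infdist_less_iff[OF ne] dist_norm by blast
      \<comment> \<open>Chosen in \<open>I\<close> so that \<open>x * y - k\<close> factors as
        \<open>(x - i) * (y - j)\<close>.\<close>
      define k where "k = j * x + (y - j) * i"
      have "k \<in> I" using I_mult[OF ij(3), of x] I_mult[OF ij(1), of "y - j"] I_add
        by (simp add: k_def mult.commute)
      moreover have "x * y - k = (x - i) * (y - j)"
        by (simp add: k_def algebra_simps)
      then have "dist (x * y) k \<le> norm (x - i) * norm (y - j)"
        by (simp add: dist_norm norm_mult_ineq)
      moreover have "norm (x - i) * norm (y - j) \<le> u * v"
        using ij by (intro mult_mono) (auto intro: order_trans[OF norm_ge_zero less_imp_le])
      ultimately show ?thesis
        using infdist_le2[of k I "x * y"] by fastforce
    qed
    show "infdist (x * y) I \<le> infdist x I * infdist y I"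
    proof (rule tendsto_lowerbound)
      show "((\<lambda>e. (infdist x I + e) * (infdist y I + e)) \<longlongrightarrow> infdist x I * infdist y I) (at_right 0)"
        by (auto intro!: tendsto_eq_intros)
      show "eventually (\<lambda>e. infdist (x * y) I \<le> (infdist x I + e) * (infdist y I + e)) (at_right 0)"
        by (rule eventually_mono[OF eventually_at_right_less]) (auto intro: mult)
    qed simp
    show "infdist 1 I \<le> 1"
      using infdist_le[OF I0, of 1] by simp
    show "infdist (z *\<^sub>C 1 * x) I \<le> cmod z * infdist x I"
    proof (rule tendsto_lowerbound)
      show "((\<lambda>e. cmod z * (infdist x I + e)) \<longlongrightarrow> cmod z * infdist x I) (at_right 0)"
        by (auto intro!: tendsto_eq_intros)
      have "infdist (z *\<^sub>C 1 * x) I \<le> cmod z * u" if u: "infdist x I < u" for u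
      proof -
        obtain i where i: "i \<in> I" "norm (x - i) < u"
          using u unfolding infdist_less_iff[OF ne] dist_norm by blast
        have "z *\<^sub>C 1 * x = z *\<^sub>C x"
          by (simp add: mult_scaleC_left)
        then have "dist (z *\<^sub>C 1 * x) (z *\<^sub>C i) = cmod z * norm (x - i)"
          using norm_scaleC[of z "x - i"] scaleC_add_right[of z "x - i" i]
          by (simp add: dist_norm)
        then show ?thesis
          using i(2) by (intro infdist_le2[OF I_scale[OF i(1), of z]]) (simp add: mult_left_mono)
      qed
      then show "eventually (\<lambda>e. infdist (z *\<^sub>C 1 * x) I \<le> cmod z * (infdist x I + e)) (at_right 0)"
        by (intro eventually_mono[OF eventually_at_right_less]) auto
    qed simp
  qed (rule N.c_add N.c_mult N.c_1 N.c_commute)+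
qed

text \<open>Gelfand--Mazur without Liouville's theorem. If \<open>x\<close> is congruent to no
  scalar modulo \<open>I\<close>, then for every multiple \<open>U\<close> of \<open>x\<close> all
  \<open>1 - z U\<close> are invertible modulo \<open>I\<close>, so some power of \<open>U\<close>
  has seminorm at most \<open>1 / 2\<close>. With \<open>U\<close> scaled to have an inverse of
  seminorm at most 1, the seminorm of 1 would be at most \<open>1 / 2\<close>.\<close>

lemma character_of_type_maximal_ideal:
  fixes I :: "'a::comm_complex_banach_algebra_1 set"
  assumes I: "type_maximal_ideal I"
  shows "\<exists>\<phi>\<in>maximal_ideal_space. \<forall>x. \<phi> x = 0 \<longleftrightarrow> x \<in> I"
proof -
  have idl: "type_ideal I" using I by (simp add: type_maximal_ideal_def)
  interpret seminormed_algebra "\<lambda>x. infdist x I" "\<lambda>z. z *\<^sub>C 1"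
    by (rule seminormed_algebra_infdist[OF idl])
  have I_diff: "x - y \<in> I" if "x \<in> I" "y \<in> I" for x y
    using that type_ideal_minus[OF idl \<open>y \<in> I\<close>] idl unfolding type_ideal_def
    by (metis add_uminus_conv_diff)
  have I_mult: "x * y \<in> I" if "y \<in> I" for x y
    using that idl by (simp add: type_ideal_def)
  have unit_notin: "u \<notin> I" if "v * u = 1" for u v
  proof
    assume "u \<in> I"
    then have "w * v * u \<in> I" for w by (rule I_mult)
    then have "w \<in> I" for w using that by (simp add: mult.assoc)
    then show False using I by (auto simp: type_maximal_ideal_def)
  qed
  \<comment> \<open>By the Neumann series, an element of \<open>I\<close> at distance less than 1
    from 1 would be a unit.\<close>
  have dist_one: "infdist 1 I \<ge> 1"
  proof (rule ccontr)
    assume "\<not> ?thesis"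
    then obtain i where "i \<in> I" "norm (1 - i) < 1"
      using infdist_less_iff[of I 1 1] idl by (auto simp: type_ideal_def dist_norm not_le)
    with unit_near_one[of "1 - i"] unit_notin show False by auto
  qed
  have inverse: "\<exists>y. is_inverse x y" if x: "x \<notin> I" for x
  proof -
    obtain a where "a * x - 1 \<in> I"
      using type_maximal_ideal_coprime[OF I x] by blast
    then have "is_inverse x a"
      by (simp add: is_inverse_def eqv_def mult.commute)
    then show ?thesis ..
  qed
  have "\<exists>l. x - l *\<^sub>C 1 \<in> I" for x
  proof (rule ccontr)
    assume "\<not> ?thesis"
    then have notin: "\<And>l. x - l *\<^sub>C 1 \<notin> I" by blast
    from notin[of 0] have "x \<notin> I" by (simp add: c_0)
    then obtain y where y: "is_inverse x y" using inverse by blast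
    \<comment> \<open>The added 1 makes \<open>r\<close> positive; dividing \<open>y\<close> by
      \<open>r\<close> brings its seminorm down to at most 1.\<close>
    define r where "r = infdist y I + 1"
    have r: "r > 0" "infdist y I \<le> r" using infdist_nonneg[of y I] by (auto simp: r_def)
    define U where "U = complex_of_real r *\<^sub>C x"
    have "\<exists>u. is_inverse (1 - z *\<^sub>C 1 * U) u" for z
    proof (cases "z = 0")
      case True
      then show ?thesis by (intro exI[of _ 1]) (simp add: is_inverse_def c_0)
    next
      case False
      define w where "w = z * of_real r"
      have "w \<noteq> 0" using False r by (simp add: w_def)
      have "z *\<^sub>C 1 * U = w *\<^sub>C x"
        by (simp add: U_def w_def mult_scaleC_left scaleC_scaleC)
      moreover have "inverse w *\<^sub>C 1 * (w *\<^sub>C x - 1) = x - inverse w *\<^sub>C 1"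
        unfolding right_diff_distrib
        using \<open>w \<noteq> 0\<close> by (simp add: mult_scaleC_left scaleC_scaleC scaleC_1)
      then have "w *\<^sub>C x - 1 \<notin> I"
        using notin[of "inverse w"] I_mult by metis
      then have "1 - w *\<^sub>C x \<notin> I"
        using type_ideal_minus[OF idl, of "1 - w *\<^sub>C x"] by auto
      ultimately have "1 - z *\<^sub>C 1 * U \<notin> I"
        by simp
      then show ?thesis by (rule inverse)
    qed
    then obtain f where "\<And>z. is_inverse (1 - z *\<^sub>C 1 * U) (f z)" by metis
    then obtain m where m: "infdist (U ^ 2 ^ m) I \<le> 1 / 2"
      using power_seminorm_less_1[of U f] by blast
    define V where "V = complex_of_real (1 / r) *\<^sub>C y"
    have "U * V = x * y"
    proof -
      have "U * V = complex_of_real r *\<^sub>C (x * (complex_of_real (1 / r) *\<^sub>C y))"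
        unfolding U_def V_def by (rule mult_scaleC_left)
      also have "\<dots> = complex_of_real r *\<^sub>C ((complex_of_real (1 / r) *\<^sub>C y) * x)"
        by (simp only: mult.commute)
      also have "\<dots> = y * x"
        unfolding mult_scaleC_left
        using r by (simp add: scaleC_scaleC scaleC_1 flip: of_real_mult)
      finally show ?thesis by (simp only: mult.commute)
    qed
    then have "eqv (U * V) 1" using y by (simp add: is_inverse_def)
    have "eqv ((U * V) ^ k) 1" for k
    proof (induction k)
      case (Suc k)
      have "eqv (U * V * (U * V) ^ k) (U * V * 1)" by (rule eqv_mult_left[OF Suc])
      also have "eqv (U * V * 1) 1" using \<open>eqv (U * V) 1\<close> by simp
      finally show ?case by simp
    qed simp
    then have "eqv 1 (U ^ 2 ^ m * V ^ 2 ^ m)"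
      by (metis eqv_sym power_mult_distrib)
    then have "infdist 1 I \<le> infdist (U ^ 2 ^ m) I * infdist (V ^ 2 ^ m) I"
      by (rule eqv_mult_bound)
    also have "\<dots> \<le> (1 / 2) * 1"
    proof (intro mult_mono m)
      have "infdist V I \<le> cmod (complex_of_real (1 / r)) * infdist y I"
        using q_scale[of "complex_of_real (1 / r)" y] by (simp add: V_def mult_scaleC_left)
      also have "\<dots> = infdist y I / r"
        using r by (simp add: norm_divide)
      also have "\<dots> \<le> 1"
        using r by (simp add: divide_le_eq)
      finally have "infdist V I \<le> 1" .
      then show "infdist (V ^ 2 ^ m) I \<le> 1"
        using q_power[of V "2 ^ m"] power_le_one[OF q_nonneg[of V]] order_trans by blast
    qed (auto simp: infdist_nonneg)
    finally show False using dist_one by simp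
  qed
  then obtain \<phi> where \<phi>: "\<And>x. x - \<phi> x *\<^sub>C 1 \<in> I" by metis
  \<comment> \<open>Two scalars congruent to \<open>x\<close> would put a nonzero multiple of 1, a
    unit, into \<open>I\<close>. The laws for \<open>\<phi>\<close> then reduce to congruences
    modulo \<open>I\<close>.\<close>
  have unique: "\<phi> x = l" if "x - l *\<^sub>C 1 \<in> I" for x l
  proof (rule ccontr)
    assume "\<phi> x \<noteq> l"
    have "(x - l *\<^sub>C 1) - (x - \<phi> x *\<^sub>C 1) = (\<phi> x - l) *\<^sub>C 1"
      using c_add[of "\<phi> x - l" l] by (simp add: algebra_simps)
    then have "(\<phi> x - l) *\<^sub>C 1 \<in> I" using I_diff[OF that \<phi>[of x]] by simp
    moreover have "inverse (\<phi> x - l) *\<^sub>C 1 * (\<phi> x - l) *\<^sub>C 1 = (1::'a)"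
      using \<open>\<phi> x \<noteq> l\<close> by (simp add: c_mult[symmetric] c_1)
    ultimately show False using unit_notin by blast
  qed
  have I_add: "x + y \<in> I" if "x \<in> I" "y \<in> I" for x y
    using that idl by (simp add: type_ideal_def)
  have "\<phi> (x + y) = \<phi> x + \<phi> y" for x y
    using I_add[OF \<phi>[of x] \<phi>[of y]] by (intro unique) (simp add: c_add algebra_simps)
  moreover have "\<phi> (c *\<^sub>C x) = c * \<phi> x" for c x
    using I_mult[OF \<phi>[of x], of "c *\<^sub>C 1"]
    by (intro unique) (simp add: right_diff_distrib mult_scaleC_left scaleC_scaleC)
  moreover have "\<phi> (x * y) = \<phi> x * \<phi> y" for x y
  proof (rule unique)
    have "x * y - (\<phi> x * \<phi> y) *\<^sub>C 1 = y * (x - \<phi> x *\<^sub>C 1) + \<phi> x *\<^sub>C 1 * (y - \<phi> y *\<^sub>C 1)"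
      by (simp add: algebra_simps c_mult)
    then show "x * y - (\<phi> x * \<phi> y) *\<^sub>C 1 \<in> I"
      using I_add[OF I_mult[OF \<phi>] I_mult[OF \<phi>]] by simp
  qed
  moreover have "\<phi> 1 = 1"
    using idl by (intro unique) (simp add: c_1 type_ideal_def)
  then have "\<exists>x. \<phi> x \<noteq> 0" by (metis zero_neq_one)
  ultimately have "\<phi> \<in> maximal_ideal_space"
    by (simp add: maximal_ideal_space_def)
  moreover have "\<phi> x = 0 \<longleftrightarrow> x \<in> I" for x
    using \<phi>[of x] unique[of x 0] by (auto simp: c_0)
  ultimately show ?thesis by blast
qed

text \<open>A non-unit lies in a maximal ideal, which is the kernel of a character.\<close>

lemma unit_of_characters_nonzero:
  fixes x :: "'a::comm_complex_banach_algebra_1"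
  assumes "\<And>\<phi>. \<phi> \<in> maximal_ideal_space \<Longrightarrow> \<phi> x \<noteq> 0"
  shows "\<exists>y. y * x = 1"
  using assms non_unit_in_type_maximal_ideal character_of_type_maximal_ideal by metis

lemma semisimple_eq_0:
  fixes x :: "'a::comm_complex_banach_algebra_1"
  assumes "semisimple TYPE('a)" "\<And>\<phi>. \<phi> \<in> maximal_ideal_space \<Longrightarrow> \<phi> x = 0"
  shows "x = 0"
proof -
  have "x \<in> I" if "type_maximal_ideal I" for I
    using character_of_type_maximal_ideal[OF that] assms(2) by metis
  then have "x \<in> \<Inter>{I. maximalideal I (ring_of_type_algebra :: 'a ring)}"
    by (simp add: maximalideal_iff_type_maximal_ideal)
  then show ?thesis using assms(1) unfolding semisimple_def by blast
qed

section \<open>The Banach algebra of square matrices\<close>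

text \<open>Cramer's rule over a commutative ring: linearity in row \<open>j\<close> turns entry
  \<open>(i, j)\<close> of \<open>M ** adj\<close> into the determinant of \<open>M\<close> with row
  \<open>j\<close> replaced by row \<open>i\<close>, which has a repeated row unless
  \<open>i = j\<close>.\<close>

lemma adjugate_right_inverse:
  fixes M :: "'a::comm_ring_1 ^ 'n ^ 'n"
  assumes "d * det M = 1"
  shows "\<exists>Y. M ** Y = mat 1"
proof -
  define adj :: "'a ^ 'n ^ 'n" where
    "adj = (\<chi> l j. det (\<chi> k. if k = j then axis l 1 else M $ k))"
  have "(M ** adj) $ i $ j = (if i = j then det M else 0)" for i j
  proof -
    have "(M ** adj) $ i $ j =
        (\<Sum>l\<in>UNIV. det (\<chi> k. if k = j then M $ i $ l *s axis l 1 else M $ k))"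
      by (simp add: matrix_matrix_mult_def adj_def det_row_mul)
    also have "\<dots> = det (\<chi> k. if k = j then (\<Sum>l\<in>UNIV. M $ i $ l *s axis l 1) else M $ k)"
      by (simp add: det_linear_row_sum)
    also have "(\<Sum>l\<in>UNIV. M $ i $ l *s axis l 1) = M $ i"
      by (simp add: basis_expansion)
    also have "det (\<chi> k. if k = j then M $ i else M $ k) = (if i = j then det M else 0)"
    proof (cases "i = j")
      case True
      then have "(\<chi> k. if k = j then M $ i else M $ k) = M"
        by (simp add: vec_eq_iff)
      with True show ?thesis by simp
    next
      case False
      then have "det (\<chi> k. if k = j then M $ i else M $ k) = 0"
        by (intro det_identical_rows[of i j]) (simp_all add: row_def vec_eq_iff)
      with False show ?thesis by simp
    qed
    finally show ?thesis .
  qed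
  then have "M ** (\<chi> l j. d * adj $ l $ j) = mat 1"
    using assms
    by (simp add: vec_eq_iff matrix_matrix_mult_def mat_def mult.left_commute sum_distrib_left[symmetric])
  then show ?thesis ..
qed

lemma matrix_inverse_of_unit_det:
  fixes M :: "'a::comm_ring_1 ^ 'n ^ 'n"
  assumes "d * det M = 1"
  shows "\<exists>Y. M ** Y = mat 1 \<and> Y ** M = mat 1"
proof -
  obtain Y where Y: "M ** Y = mat 1"
    using adjugate_right_inverse[OF assms] ..
  \<comment> \<open>The transpose has the same determinant; transposing its right inverse gives a
    left inverse of \<open>M\<close>.\<close>
  obtain Z where "transpose M ** Z = mat 1"
    using adjugate_right_inverse[of d "transpose M"] assms by auto
  then have Z: "transpose Z ** M = mat 1"
    by (metis matrix_transpose_mul transpose_mat transpose_transpose)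
  have "transpose Z = transpose Z ** (M ** Y)"
    by (simp add: Y)
  also have "\<dots> = Y"
    by (simp add: matrix_mul_assoc Z)
  finally show ?thesis
    using Y Z by blast
qed

text \<open>The type \<open>'a ^ 'n ^ 'n\<close> multiplies entrywise; a copy of it is made into a Banach algebra,
  with the maximal row sum as norm.\<close>

typedef (overloaded) ('a, 'n::finite) sqmat = "UNIV :: ('a ^ 'n ^ 'n) set"
  morphisms mat_of Sqmat ..

setup_lifting type_definition_sqmat

definition row_sum_norm :: "'a::real_normed_vector ^ 'n ^ 'n \<Rightarrow> real" where
  "row_sum_norm A = Max (range (\<lambda>i. \<Sum>j\<in>UNIV. norm (A $ i $ j)))"

lemma row_sum_norm_le_iff: "row_sum_norm A \<le> K \<longleftrightarrow> (\<forall>i. (\<Sum>j\<in>UNIV. norm (A $ i $ j)) \<le> K)"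
  by (simp add: row_sum_norm_def)

lemma row_le_row_sum_norm: "(\<Sum>j\<in>UNIV. norm (A $ i $ j)) \<le> row_sum_norm A"
  using row_sum_norm_le_iff[of A "row_sum_norm A"] by simp

lemma entry_le_row_sum_norm: "norm (A $ i $ j) \<le> row_sum_norm A"
proof -
  have "norm (A $ i $ j) \<le> (\<Sum>j\<in>UNIV. norm (A $ i $ j))"
    by (rule member_le_sum) auto
  then show ?thesis
    using row_le_row_sum_norm[of A i] by linarith
qed

lemma row_sum_norm_nonneg: "0 \<le> row_sum_norm A"
  using entry_le_row_sum_norm[of A undefined undefined] norm_ge_zero order_trans by blast

lemma row_sum_norm_attained: "\<exists>i. row_sum_norm A = (\<Sum>j\<in>UNIV. norm (A $ i $ j))"
proof -
  have "row_sum_norm A \<in> range (\<lambda>i. \<Sum>j\<in>UNIV. norm (A $ i $ j))"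
    unfolding row_sum_norm_def by (rule Max_in) auto
  then show ?thesis by auto
qed

lemma row_sum_norm_mult:
  fixes A B :: "'a::real_normed_algebra_1 ^ 'n ^ 'n"
  shows "row_sum_norm (A ** B) \<le> row_sum_norm A * row_sum_norm B"
  unfolding row_sum_norm_le_iff
proof
  fix i
  have "(\<Sum>k\<in>UNIV. norm ((A ** B) $ i $ k))
      \<le> (\<Sum>k\<in>UNIV. \<Sum>j\<in>UNIV. norm (A $ i $ j) * norm (B $ j $ k))"
    by (intro sum_mono) (simp add: matrix_matrix_mult_def norm_mult_ineq sum_norm_le)
  also have "\<dots> = (\<Sum>j\<in>UNIV. norm (A $ i $ j) * (\<Sum>k\<in>UNIV. norm (B $ j $ k)))"
    by (subst sum.swap) (simp add: sum_distrib_left)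
  also have "\<dots> \<le> (\<Sum>j\<in>UNIV. norm (A $ i $ j) * row_sum_norm B)"
    by (intro sum_mono mult_left_mono row_le_row_sum_norm) auto
  also have "\<dots> \<le> row_sum_norm A * row_sum_norm B"
    unfolding sum_distrib_right[symmetric]
    by (intro mult_right_mono row_le_row_sum_norm row_sum_norm_nonneg)
  finally show "(\<Sum>k\<in>UNIV. norm ((A ** B) $ i $ k)) \<le> row_sum_norm A * row_sum_norm B" .
qed

instantiation sqmat :: (real_normed_algebra_1, finite) real_normed_algebra_1
begin

lift_definition zero_sqmat :: "('a, 'b) sqmat" is 0 .
lift_definition one_sqmat :: "('a, 'b) sqmat" is "mat 1" .
lift_definition plus_sqmat :: "('a, 'b) sqmat \<Rightarrow> ('a, 'b) sqmat \<Rightarrow> ('a, 'b) sqmat" is "(+)" .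
lift_definition minus_sqmat :: "('a, 'b) sqmat \<Rightarrow> ('a, 'b) sqmat \<Rightarrow> ('a, 'b) sqmat" is "(-)" .
lift_definition uminus_sqmat :: "('a, 'b) sqmat \<Rightarrow> ('a, 'b) sqmat" is uminus .
lift_definition times_sqmat :: "('a, 'b) sqmat \<Rightarrow> ('a, 'b) sqmat \<Rightarrow> ('a, 'b) sqmat" is "(**)" .
lift_definition scaleR_sqmat :: "real \<Rightarrow> ('a, 'b) sqmat \<Rightarrow> ('a, 'b) sqmat" is scaleR .
lift_definition norm_sqmat :: "('a, 'b) sqmat \<Rightarrow> real" is row_sum_norm .

definition dist_sqmat :: "('a, 'b) sqmat \<Rightarrow> ('a, 'b) sqmat \<Rightarrow> real" where
  "dist_sqmat x y = norm (x - y)"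
definition sgn_sqmat :: "('a, 'b) sqmat \<Rightarrow> ('a, 'b) sqmat" where
  "sgn_sqmat x = inverse (norm x) *\<^sub>R x"
definition uniformity_sqmat :: "(('a, 'b) sqmat \<times> ('a, 'b) sqmat) filter" where
  "uniformity_sqmat = (INF e\<in>{0 <..}. principal {(x, y). dist x y < e})"
definition open_sqmat :: "('a, 'b) sqmat set \<Rightarrow> bool" where
  "open_sqmat S = (\<forall>x\<in>S. \<forall>\<^sub>F (x', y) in uniformity. x' = x \<longrightarrow> y \<in> S)"

instance
proof
  fix x y z :: "('a, 'b) sqmat" and r s :: real
  show "x + y + z = x + (y + z)" "x + y = y + x" "0 + x = x" "- x + x = 0" "x - y = x + - y"
    by (transfer, simp)+
  show "x * y * z = x * (y * z)"
    by transfer (rule matrix_mul_assoc[symmetric])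
  show "(x + y) * z = x * z + y * z"
    by transfer (simp add: vec_eq_iff matrix_matrix_mult_def distrib_right sum.distrib)
  show "x * (y + z) = x * y + x * z"
    by transfer (simp add: vec_eq_iff matrix_matrix_mult_def distrib_left sum.distrib)
  show "1 * x = x" "x * 1 = x"
    by (transfer, simp)+
  show "(0 :: ('a, 'b) sqmat) \<noteq> 1"
  proof (transfer, rule notI)
    assume "(0 :: 'a ^ 'b ^ 'b) = mat 1"
    then have "(0 :: 'a ^ 'b ^ 'b) $ i $ i = mat 1 $ i $ i" for i by simp
    then show False by (simp add: mat_def)
  qed
  show "r *\<^sub>R (x + y) = r *\<^sub>R x + r *\<^sub>R y" "(r + s) *\<^sub>R x = r *\<^sub>R x + s *\<^sub>R x"
      "r *\<^sub>R s *\<^sub>R x = (r * s) *\<^sub>R x" "1 *\<^sub>R x = x"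
    by (transfer, simp add: algebra_simps)+
  show "r *\<^sub>R x * y = r *\<^sub>R (x * y)" "x * r *\<^sub>R y = r *\<^sub>R (x * y)"
    by (transfer, simp add: vec_eq_iff matrix_matrix_mult_def scaleR_right.sum)+
  show "norm (x + y) \<le> norm x + norm y"
  proof (transfer)
    fix x y :: "'a ^ 'b ^ 'b"
    show "row_sum_norm (x + y) \<le> row_sum_norm x + row_sum_norm y"
      unfolding row_sum_norm_le_iff
    proof
      fix i
      have "(\<Sum>j\<in>UNIV. norm ((x + y) $ i $ j))
          \<le> (\<Sum>j\<in>UNIV. norm (x $ i $ j)) + (\<Sum>j\<in>UNIV. norm (y $ i $ j))"
        unfolding sum.distrib[symmetric] by (intro sum_mono) (simp add: norm_triangle_ineq)
      also have "\<dots> \<le> row_sum_norm x + row_sum_norm y"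
        by (intro add_mono row_le_row_sum_norm)
      finally show "(\<Sum>j\<in>UNIV. norm ((x + y) $ i $ j)) \<le> row_sum_norm x + row_sum_norm y" .
    qed
  qed
  show "norm (r *\<^sub>R x) = \<bar>r\<bar> * norm x"
  proof (transfer)
    fix r and x :: "'a ^ 'b ^ 'b"
    obtain i where "row_sum_norm x = (\<Sum>j\<in>UNIV. norm (x $ i $ j))"
      using row_sum_norm_attained by blast
    then have "\<bar>r\<bar> * row_sum_norm x \<le> row_sum_norm (r *\<^sub>R x)"
      using row_le_row_sum_norm[of "r *\<^sub>R x" i] by (simp add: sum_distrib_left)
    moreover have "row_sum_norm (r *\<^sub>R x) \<le> \<bar>r\<bar> * row_sum_norm x"
      unfolding row_sum_norm_le_iff
      by (simp add: sum_distrib_left[symmetric] mult_left_mono row_le_row_sum_norm)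
    ultimately show "row_sum_norm (r *\<^sub>R x) = \<bar>r\<bar> * row_sum_norm x" by simp
  qed
  show "norm x = 0 \<longleftrightarrow> x = 0"
  proof (transfer)
    fix x :: "'a ^ 'b ^ 'b"
    have "x = 0" if "row_sum_norm x = 0"
      using entry_le_row_sum_norm[of x] that by (simp add: vec_eq_iff)
    moreover have "row_sum_norm (0 :: 'a ^ 'b ^ 'b) = 0"
      using row_sum_norm_attained[of "0 :: 'a ^ 'b ^ 'b"] by simp
    ultimately show "row_sum_norm x = 0 \<longleftrightarrow> x = 0" by auto
  qed
  show "norm (x * y) \<le> norm x * norm y"
    by transfer (rule row_sum_norm_mult)
  show "norm (1 :: ('a, 'b) sqmat) = 1"
  proof transfer
    have "(\<Sum>j\<in>UNIV. norm ((mat 1 :: 'a ^ 'b ^ 'b) $ i $ j)) = 1" for i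
    proof -
      have "(\<Sum>j\<in>UNIV. norm ((mat 1 :: 'a ^ 'b ^ 'b) $ i $ j)) = (\<Sum>j\<in>UNIV. if i = j then 1 else 0)"
        by (intro sum.cong) (auto simp: mat_def)
      then show ?thesis by simp
    qed
    then show "row_sum_norm (mat 1 :: 'a ^ 'b ^ 'b) = 1"
      by (simp add: row_sum_norm_def)
  qed
qed (simp_all add: dist_sqmat_def sgn_sqmat_def uniformity_sqmat_def open_sqmat_def)

end

lemma bounded_linear_entry: "bounded_linear (\<lambda>M :: ('a::real_normed_algebra_1, 'n::finite) sqmat. mat_of M $ i $ j)"
  by (rule bounded_linear_intro[of _ 1])
    (simp_all add: plus_sqmat.rep_eq scaleR_sqmat.rep_eq norm_sqmat.rep_eq entry_le_row_sum_norm)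

lemma norm_sqmat_le_sum: "norm (M :: ('a::real_normed_algebra_1, 'n::finite) sqmat)
    \<le> (\<Sum>i\<in>UNIV. \<Sum>j\<in>UNIV. norm (mat_of M $ i $ j))"
  unfolding norm_sqmat.rep_eq row_sum_norm_le_iff
  by (auto intro!: member_le_sum[of _ UNIV "\<lambda>i. \<Sum>j\<in>UNIV. norm (mat_of M $ i $ j)"] sum_nonneg)

lemma tendsto_sqmat:
  fixes M :: "'b \<Rightarrow> ('a::real_normed_algebra_1, 'n::finite) sqmat"
  assumes "\<And>i j. ((\<lambda>n. mat_of (M n) $ i $ j) \<longlongrightarrow> mat_of L $ i $ j) F"
  shows "(M \<longlongrightarrow> L) F"
proof -
  have "((\<lambda>n. \<Sum>i\<in>UNIV. \<Sum>j\<in>UNIV. norm (mat_of (M n) $ i $ j - mat_of L $ i $ j))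
      \<longlongrightarrow> (\<Sum>i\<in>(UNIV::'n set). \<Sum>j\<in>(UNIV::'n set). norm (mat_of L $ i $ j - mat_of L $ i $ j))) F"
    by (intro tendsto_intros assms)
  then have "((\<lambda>n. \<Sum>i\<in>UNIV. \<Sum>j\<in>UNIV. norm (mat_of (M n - L) $ i $ j)) \<longlongrightarrow> 0) F"
    by (simp add: minus_sqmat.rep_eq)
  then have "((\<lambda>n. M n - L) \<longlongrightarrow> 0) F"
    by (rule Lim_null_comparison[rotated]) (simp add: norm_sqmat_le_sum)
  then show ?thesis by (rule LIM_zero_cancel)
qed

instance sqmat :: ("{real_normed_algebra_1, banach}", finite) banach
proof
  fix M :: "nat \<Rightarrow> ('a, 'b) sqmat"
  assume "Cauchy M"
  then have "convergent (\<lambda>n. mat_of (M n) $ i $ j)" for i j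
    by (intro Cauchy_convergent bounded_linear.Cauchy[OF bounded_linear_entry])
  then obtain L where "\<And>i j. (\<lambda>n. mat_of (M n) $ i $ j) \<longlonglongrightarrow> L i j"
    unfolding convergent_def by metis
  then have "M \<longlonglongrightarrow> Sqmat (\<chi> i j. L i j)"
    by (intro tendsto_sqmat) (simp add: Sqmat_inverse)
  then show "convergent M" by (auto simp: convergent_def)
qed

section \<open>Matrix exponentials\<close>

lemma mat_of_power: "mat_of (M ^ k) = mat_pow (mat_of M) k"
  by (induction k) (simp_all add: one_sqmat.rep_eq times_sqmat.rep_eq)

lemma bounded_linear_mat_of:
  "bounded_linear (mat_of :: ('a::real_normed_algebra_1, 'n::finite) sqmat \<Rightarrow> _)"
proof (rule bounded_linear_intro[of _ "real CARD('n)"])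
  fix M :: "('a, 'n) sqmat"
  have "norm (mat_of M) \<le> (\<Sum>i\<in>UNIV. norm (mat_of M $ i))"
    unfolding norm_vec_def by (rule L2_set_le_sum) simp
  also have "\<dots> \<le> (\<Sum>i\<in>(UNIV::'n set). norm M)"
  proof (rule sum_mono)
    fix i
    have "norm (mat_of M $ i) \<le> (\<Sum>j\<in>UNIV. norm (mat_of M $ i $ j))"
      unfolding norm_vec_def by (rule L2_set_le_sum) simp
    then show "norm (mat_of M $ i) \<le> norm M"
      using row_le_row_sum_norm[of "mat_of M" i] by (simp add: norm_sqmat.rep_eq)
  qed
  finally show "norm (mat_of M) \<le> norm M * real CARD('n)"
    by (simp add: mult.commute)
qed (simp_all add: plus_sqmat.rep_eq scaleR_sqmat.rep_eq)

lemma mat_exp_eq: "mat_exp A = mat_of (exp (Sqmat A :: ('a::{real_normed_algebra_1, banach}, 'n::finite) sqmat))"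
proof -
  have "mat_of (exp (Sqmat A)) = (\<Sum>k. mat_of (Sqmat A ^ k /\<^sub>R fact k))"
    unfolding exp_def
    by (rule bounded_linear.suminf[OF bounded_linear_mat_of summable_exp_generic])
  then show ?thesis
    by (simp add: mat_exp_def scaleR_sqmat.rep_eq mat_of_power Sqmat_inverse divide_inverse)
qed

text \<open>Carries decay estimates from the row sum norm over to
  \<open>exponentially_stable\<close>, which asks for upper bounds of
  \<open>op_norm\<close>.\<close>

lemma op_norm_le: "op_norm A \<le> norm (Sqmat A :: ('a::real_normed_algebra_1, 'n::finite) sqmat)"
  unfolding op_norm_def
proof (rule cSUP_least)
  show "{v :: 'a ^ 'n. max_norm v \<le> 1} \<noteq> {}"
    by (auto intro!: exI[of _ 0] simp: max_norm_def)
  fix v :: "'a ^ 'n" assume "v \<in> {v. max_norm v \<le> 1}"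
  then have v: "norm (v $ j) \<le> 1" for j
    by (simp add: max_norm_def)
  have "norm ((A *v v) $ i) \<le> norm (Sqmat A)" for i
  proof -
    have "norm ((A *v v) $ i) \<le> (\<Sum>j\<in>UNIV. norm (A $ i $ j) * norm (v $ j))"
      by (simp add: matrix_vector_mult_def norm_mult_ineq sum_norm_le)
    also have "\<dots> \<le> (\<Sum>j\<in>UNIV. norm (A $ i $ j) * 1)"
      by (intro sum_mono mult_left_mono v) auto
    also have "\<dots> \<le> norm (Sqmat A)"
      using row_le_row_sum_norm[of A i] by (simp add: norm_sqmat.rep_eq Sqmat_inverse)
    finally show ?thesis .
  qed
  then show "max_norm (A *v v) \<le> norm (Sqmat A)"
    by (simp add: max_norm_def)
qed

text \<open>Respecting powers of \<open>x\<close> is enough, so this covers the conjugate transpose,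
  which reverses products, as well as characters and conjugations.\<close>

lemma exp_power_hom:
  fixes h :: "'b::{real_normed_algebra_1, banach} \<Rightarrow> 'c::{real_normed_algebra_1, banach}"
  assumes "bounded_linear h" "\<And>k. h (x ^ k) = h x ^ k"
  shows "h (exp x) = exp (h x)"
proof -
  have "h (exp x) = (\<Sum>k. h (x ^ k /\<^sub>R fact k))"
    unfolding exp_def
    by (rule bounded_linear.suminf[OF assms(1) summable_exp_generic])
  then show ?thesis
    by (simp add: exp_def bounded_linear.linear[OF assms(1), THEN linear_scale] assms(2))
qed

lemma exp_scaleR_of_nat: "exp (real k *\<^sub>R x) = exp x ^ k"
  for x :: "'b::{real_normed_algebra_1, banach}"
proof (induction k)
  case (Suc k)
  have "exp (real (Suc k) *\<^sub>R x) = exp (x + real k *\<^sub>R x)"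
    by (simp add: scaleR_left_distrib)
  also have "\<dots> = exp x * exp (real k *\<^sub>R x)"
    by (rule exp_add_commuting) simp
  finally show ?case by (simp add: Suc)
qed simp

text \<open>Write \<open>t = N k + s\<close> with \<open>0 \<le> s \<le> N\<close>. The
  \<open>k\<close> full periods contribute \<open>(1 / 2) ^ k\<close>, the remainder at most
  \<open>exp (N * norm M)\<close>. This gives the rate \<open>ln 2 / N\<close>; the 2 in
  \<open>K\<close> pays for rounding \<open>t / N\<close> down.\<close>

lemma exp_decay:
  fixes M :: "'b::{real_normed_algebra_1, banach}"
  assumes "norm (exp M ^ N) \<le> 1 / 2" "N > 0"
  shows "\<exists>K>0. \<exists>\<epsilon>>0. \<forall>t\<ge>0. norm (exp (t *\<^sub>R M)) \<le> K * exp (- \<epsilon> * t)"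
proof -
  define \<epsilon> where "\<epsilon> = ln 2 / real N"
  define K where "K = 2 * exp (real N * norm M)"
  have "norm (exp (t *\<^sub>R M)) \<le> K * exp (- \<epsilon> * t)" if "t \<ge> 0" for t
  proof -
    define k where "k = nat \<lfloor>t / real N\<rfloor>"
    define s where "s = t - real (N * k)"
    have "real k \<le> t / real N" "t / real N \<le> real k + 1"
      using that assms(2) by (simp_all add: k_def)
    then have s: "0 \<le> s" "s \<le> real N" and k: "t / real N - 1 \<le> real k"
      using assms(2) by (simp_all add: s_def field_simps)
    have "exp (t *\<^sub>R M) = exp (real (N * k) *\<^sub>R M + s *\<^sub>R M)"
      by (simp add: s_def flip: scaleR_left.add)
    also have "\<dots> = exp (real (N * k) *\<^sub>R M) * exp (s *\<^sub>R M)"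
      by (rule exp_add_commuting) simp
    also have "exp (real (N * k) *\<^sub>R M) = (exp M ^ N) ^ k"
      by (simp only: exp_scaleR_of_nat power_mult)
    finally have "norm (exp (t *\<^sub>R M)) \<le> norm ((exp M ^ N) ^ k) * norm (exp (s *\<^sub>R M))"
      by (simp add: norm_mult_ineq)
    also have "\<dots> \<le> (1 / 2) ^ k * exp (real N * norm M)"
    proof (intro mult_mono)
      show "norm ((exp M ^ N) ^ k) \<le> (1 / 2) ^ k"
        by (rule order_trans[OF norm_power_ineq power_mono[OF assms(1)]]) simp
      have "norm (exp (s *\<^sub>R M)) \<le> exp (norm (s *\<^sub>R M))"
        by (rule norm_exp)
      also have "\<dots> \<le> exp (real N * norm M)"
        using s by (simp add: mult_right_mono)
      finally show "norm (exp (s *\<^sub>R M)) \<le> exp (real N * norm M)" .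
    qed auto
    also have "(1 / 2) ^ k = exp (- ln 2 * real k)"
      by (simp add: exp_minus exp_of_nat2_mult power_one_over inverse_eq_divide)
    also have "\<dots> \<le> exp (ln 2 - \<epsilon> * t)"
    proof -
      have "ln 2 * (t / real N - 1) \<le> ln 2 * real k"
        using k by (intro mult_left_mono) auto
      then show ?thesis by (simp add: \<epsilon>_def algebra_simps)
    qed
    also have "exp (ln 2 - \<epsilon> * t) * exp (real N * norm M) = K * exp (- \<epsilon> * t)"
      by (simp add: K_def exp_diff exp_minus field_simps)
    finally show ?thesis by simp
  qed
  moreover have "K > 0" "\<epsilon> > 0"
    using assms(2) by (simp_all add: K_def \<epsilon>_def)
  ultimately show ?thesis by blast
qed

section \<open>Characters on matrices and eigenvectors\<close>

locale character =
  fixes \<phi> :: "'a::comm_complex_banach_algebra_1 \<Rightarrow> complex"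
  assumes character: "\<phi> \<in> maximal_ideal_space"
begin

lemma add: "\<phi> (x + y) = \<phi> x + \<phi> y"
  and scaleC: "\<phi> (c *\<^sub>C x) = c * \<phi> x"
  and mult: "\<phi> (x * y) = \<phi> x * \<phi> y"
  using character by (simp_all add: maximal_ideal_space_def)

lemma one: "\<phi> 1 = 1"
proof -
  obtain x where "\<phi> x \<noteq> 0"
    using character by (auto simp: maximal_ideal_space_def)
  then show ?thesis
    using mult[of x 1] by simp
qed

lemma zero: "\<phi> 0 = 0"
  using add[of 0 0] by simp

lemma minus: "\<phi> (- x) = - \<phi> x"
  using add[of x "- x"] by (simp add: zero eq_neg_iff_add_eq_0 add.commute)

lemma diff: "\<phi> (x - y) = \<phi> x - \<phi> y"
  using add[of x "- y"] by (simp add: minus)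

lemma sum: "\<phi> (sum f S) = (\<Sum>i\<in>S. \<phi> (f i))"
  by (induction S rule: infinite_finite_induct) (simp_all add: zero add)

lemma prod: "\<phi> (prod f S) = (\<Prod>i\<in>S. \<phi> (f i))"
  by (induction S rule: infinite_finite_induct) (simp_all add: one mult)

lemma scaleR: "\<phi> (r *\<^sub>R x) = of_real r * \<phi> x"
  using scaleC[of "of_real r" x] by (simp add: scaleC_of_real)

lemma of_int: "\<phi> (of_int k) = of_int k"
proof -
  have "\<phi> (of_nat n) = of_nat n" for n
    by (induction n) (simp_all add: zero one add)
  then show ?thesis
    by (cases k rule: int_cases2) (simp_all add: minus)
qed

text \<open>Characters are automatically contractive: otherwise the Neumann series would make
  \<open>1 - x / \<phi> x\<close> a unit, although \<open>\<phi>\<close> sends it to 0.\<close>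

lemma norm_le: "cmod (\<phi> x) \<le> norm x"
proof (rule ccontr)
  assume "\<not> ?thesis"
  then have less: "norm x < cmod (\<phi> x)" by simp
  then have "\<phi> x \<noteq> 0" using norm_ge_zero[of x] by auto
  have "norm (inverse (\<phi> x) *\<^sub>C x) < 1"
    using less \<open>\<phi> x \<noteq> 0\<close> by (simp add: norm_scaleC norm_divide field_simps)
  then obtain y where "y * (1 - inverse (\<phi> x) *\<^sub>C x) = 1"
    using unit_near_one by blast
  then have "\<phi> y * (1 - inverse (\<phi> x) * \<phi> x) = 1"
    by (metis one mult diff scaleC)
  then show False using \<open>\<phi> x \<noteq> 0\<close> by simp
qed

lemma det: "\<phi> (det A) = det (gelfand_mat A \<phi>)"
  by (simp add: det_def sum prod mult of_int gelfand_mat_def gelfand_def)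

lemma gelfand_mat_mult: "gelfand_mat (A ** B) \<phi> = gelfand_mat A \<phi> ** gelfand_mat B \<phi>"
  by (simp add: vec_eq_iff gelfand_mat_def gelfand_def matrix_matrix_mult_def sum mult)

lemma gelfand_mat_add: "gelfand_mat (A + B) \<phi> = gelfand_mat A \<phi> + gelfand_mat B \<phi>"
  by (simp add: vec_eq_iff gelfand_mat_def gelfand_def add)

lemma gelfand_mat_diff: "gelfand_mat (A - B) \<phi> = gelfand_mat A \<phi> - gelfand_mat B \<phi>"
  by (simp add: vec_eq_iff gelfand_mat_def gelfand_def diff)

lemma gelfand_mat_minus: "gelfand_mat (- A) \<phi> = - gelfand_mat A \<phi>"
  by (simp add: vec_eq_iff gelfand_mat_def gelfand_def minus)

lemma gelfand_mat_one: "gelfand_mat (mat 1) \<phi> = mat 1"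
  by (simp add: vec_eq_iff gelfand_mat_def gelfand_def mat_def one zero)

end

definition gelfand_sqmat :: "('a::comm_complex_banach_algebra_1 \<Rightarrow> complex) \<Rightarrow> ('a, 'n::finite) sqmat \<Rightarrow> (complex, 'n) sqmat" where
  "gelfand_sqmat \<phi> M = Sqmat (gelfand_mat (mat_of M) \<phi>)"

context character
begin

lemma mat_of_gelfand_sqmat: "mat_of (gelfand_sqmat \<phi> M) = gelfand_mat (mat_of M) \<phi>"
  by (simp add: gelfand_sqmat_def Sqmat_inverse)

lemma gelfand_sqmat_mult: "gelfand_sqmat \<phi> (M * N) = gelfand_sqmat \<phi> M * gelfand_sqmat \<phi> N"
  by (simp add: mat_of_inject[symmetric] mat_of_gelfand_sqmat times_sqmat.rep_eq gelfand_mat_mult)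

lemma gelfand_sqmat_one: "gelfand_sqmat \<phi> 1 = 1"
  by (simp add: mat_of_inject[symmetric] mat_of_gelfand_sqmat one_sqmat.rep_eq gelfand_mat_one)

lemma gelfand_sqmat_power: "gelfand_sqmat \<phi> (M ^ k) = gelfand_sqmat \<phi> M ^ k"
  by (induction k) (simp_all add: gelfand_sqmat_one gelfand_sqmat_mult)

lemma bounded_linear_gelfand_sqmat: "bounded_linear (gelfand_sqmat \<phi>)"
proof (rule bounded_linear_intro[of _ 1])
  fix M N :: "('a, 'n::finite) sqmat" and r
  show "gelfand_sqmat \<phi> (M + N) = gelfand_sqmat \<phi> M + gelfand_sqmat \<phi> N"
    by (simp add: mat_of_inject[symmetric] mat_of_gelfand_sqmat plus_sqmat.rep_eq gelfand_mat_add)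
  show "gelfand_sqmat \<phi> (r *\<^sub>R M) = r *\<^sub>R gelfand_sqmat \<phi> M"
    unfolding mat_of_inject[symmetric]
    by (simp add: mat_of_gelfand_sqmat scaleR_sqmat.rep_eq)
      (simp add: vec_eq_iff gelfand_mat_def gelfand_def scaleR scaleR_conv_of_real[where 'a = complex])
  have "norm (gelfand_sqmat \<phi> M) \<le> norm M"
    unfolding norm_sqmat.rep_eq row_sum_norm_le_iff mat_of_gelfand_sqmat
  proof
    fix i
    have "(\<Sum>j\<in>UNIV. norm (gelfand_mat (mat_of M) \<phi> $ i $ j)) \<le> (\<Sum>j\<in>UNIV. norm (mat_of M $ i $ j))"
      by (intro sum_mono) (simp add: gelfand_mat_def gelfand_def norm_le)
    then show "(\<Sum>j\<in>UNIV. norm (gelfand_mat (mat_of M) \<phi> $ i $ j)) \<le> row_sum_norm (mat_of M)"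
      using row_le_row_sum_norm order_trans by blast
  qed
  then show "norm (gelfand_sqmat \<phi> M) \<le> norm M * 1" by simp
qed

lemma gelfand_sqmat_exp: "gelfand_sqmat \<phi> (exp M) = exp (gelfand_sqmat \<phi> M)"
  by (rule exp_power_hom[OF bounded_linear_gelfand_sqmat gelfand_sqmat_power])

end

text \<open>The bridge from characters to the algebra: the determinant vanishes at no character, so
  it is a unit, and Cramer's rule inverts the matrix.\<close>

lemma sqmat_unit_of_trivial_kernels:
  fixes M :: "('a::comm_complex_banach_algebra_1, 'n::finite) sqmat"
  assumes "\<And>\<phi> v. \<phi> \<in> maximal_ideal_space \<Longrightarrow> mat_of (gelfand_sqmat \<phi> M) *v v = 0 \<Longrightarrow> v = 0"
  shows "\<exists>N. M * N = 1 \<and> N * M = 1"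
proof -
  have "\<phi> (det (mat_of M)) \<noteq> 0" if "\<phi> \<in> maximal_ideal_space" for \<phi>
  proof -
    interpret character \<phi> by unfold_locales fact
    have "\<exists>B. B ** gelfand_mat (mat_of M) \<phi> = mat 1"
      using assms[OF that] unfolding matrix_left_invertible_ker mat_of_gelfand_sqmat by blast
    then have "invertible (gelfand_mat (mat_of M) \<phi>)"
      by (simp add: invertible_left_inverse)
    then show ?thesis
      by (simp add: det invertible_det_nz)
  qed
  then obtain d where "d * det (mat_of M) = 1"
    using unit_of_characters_nonzero by blast
  then obtain N where "mat_of M ** N = mat 1" "N ** mat_of M = mat 1"
    using matrix_inverse_of_unit_det by blast
  then have "M * Sqmat N = 1 \<and> Sqmat N * M = 1"
    by (simp add: mat_of_inject[symmetric] times_sqmat.rep_eq one_sqmat.rep_eq Sqmat_inverse)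
  then show ?thesis by blast
qed

section \<open>Eigenvectors in invariant subspaces, and spectral mapping for the exponential\<close>

definition poly_apply :: "complex poly \<Rightarrow> complex ^ 'n ^ 'n \<Rightarrow> complex ^ 'n \<Rightarrow> complex ^ 'n" where
  "poly_apply p M v = fold_coeffs (\<lambda>a w. a *s v + M *v w) p 0"

lemma poly_apply_0: "poly_apply 0 M v = 0"
  by (simp add: poly_apply_def)

lemma poly_apply_pCons: "poly_apply (pCons a p) M v = a *s v + M *v poly_apply p M v"
  by (cases "p = 0 \<and> a = 0") (auto simp: poly_apply_def fold_coeffs_pCons_not_0_0_eq)

lemma poly_apply_add: "poly_apply (p + q) M v = poly_apply p M v + poly_apply q M v"
  by (induction p q rule: poly_induct2)
    (simp_all add: poly_apply_0 poly_apply_pCons vec.scale_left_distrib matrix_vector_right_distrib)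

lemma poly_apply_smult: "poly_apply (Polynomial.smult c p) M v = c *s poly_apply p M v"
  by (induction p)
    (simp_all add: poly_apply_0 poly_apply_pCons vec.scale_right_distrib vector_scalar_commute)

lemma poly_apply_monom: "poly_apply (Polynomial.monom c k) M v = c *s (((*v) M ^^ k) v)"
  by (induction k)
    (simp_all add: monom_0 monom_Suc poly_apply_0 poly_apply_pCons vector_scalar_commute)

lemma poly_apply_sum: "poly_apply (sum p S) M v = (\<Sum>i\<in>S. poly_apply (p i) M v)"
  by (induction S rule: infinite_finite_induct) (simp_all add: poly_apply_0 poly_apply_add)

text \<open>The iterates of \<open>v\<close> with exponents \<open>0, ..., n\<close> are one more
  than the dimension. Linear dependence concerns sets, so a repetition among them is a separate
  case.\<close>

lemma annihilating_polynomial: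
  fixes M :: "complex ^ 'n ^ 'n"
  shows "\<exists>p. p \<noteq> 0 \<and> poly_apply p M v = 0"
proof -
  define f where "f i = ((*v) M ^^ i) v" for i
  let ?I = "{..CARD('n)}"
  show ?thesis
  proof (cases "inj_on f ?I")
    case False
    then obtain i j where ij: "i \<noteq> j" "f i = f j" by (auto simp: inj_on_def)
    define p where "p = Polynomial.monom 1 i + Polynomial.monom (- 1 :: complex) j"
    have "Polynomial.coeff p i \<noteq> 0" using ij by (simp add: p_def)
    then have "p \<noteq> 0" by auto
    moreover have "poly_apply p M v = 0"
      using ij by (simp add: p_def poly_apply_add poly_apply_monom f_def)
    ultimately show ?thesis by blast
  next
    case True
    then have "card (f ` ?I) = CARD('n) + 1" by (simp add: card_image)
    then have "vec.dependent (f ` ?I)"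
      using vec.independent_card_le_dim[of "f ` ?I" UNIV] by (auto simp: card_cart_basis)
    then obtain u where u: "\<exists>w\<in>f ` ?I. u w \<noteq> 0" "(\<Sum>w\<in>f ` ?I. u w *s w) = 0"
      by (subst (asm) vec.dependent_finite) auto
    define p where "p = (\<Sum>i\<in>?I. Polynomial.monom (u (f i)) i)"
    obtain k where k: "k \<in> ?I" "u (f k) \<noteq> 0" using u(1) by auto
    have "Polynomial.coeff p k = (\<Sum>i\<in>?I. if i = k then u (f i) else 0)"
      unfolding p_def coeff_sum by (intro sum.cong) auto
    also have "\<dots> = u (f k)" using k(1) by simp
    finally have "p \<noteq> 0" using k(2) by auto
    moreover have "poly_apply p M v = (\<Sum>i\<in>?I. u (f i) *s f i)"
      by (simp add: p_def poly_apply_sum poly_apply_monom f_def)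
    then have "poly_apply p M v = 0"
      using u(2) by (simp add: sum.reindex[OF True])
    ultimately show ?thesis by blast
  qed
qed

text \<open>Split a root off an annihilating polynomial, \<open>p = (X - l) q\<close>. Either
  \<open>q\<close> applied to \<open>v\<close> is an eigenvector for \<open>l\<close>, or
  \<open>q\<close> annihilates \<open>v\<close> and has smaller degree.\<close>

lemma eigenvector_in_invariant_subspace:
  fixes M :: "complex ^ 'n ^ 'n"
  assumes S: "\<And>u w. u \<in> S \<Longrightarrow> w \<in> S \<Longrightarrow> u + w \<in> S" "\<And>c u. u \<in> S \<Longrightarrow> c *s u \<in> S"
      "\<And>u. u \<in> S \<Longrightarrow> M *v u \<in> S"
    and v: "v \<in> S" "v \<noteq> 0"
  shows "\<exists>w l. w \<in> S \<and> w \<noteq> 0 \<and> M *v w = l *s w"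
proof -
  have in_S: "poly_apply p M v \<in> S" for p
  proof (induction p)
    case 0
    show ?case using S(2)[OF v(1), of 0] by (simp add: poly_apply_0)
  qed (use S v in \<open>simp add: poly_apply_pCons\<close>)
  obtain p where "p \<noteq> 0" "poly_apply p M v = 0"
    using annihilating_polynomial by blast
  then show ?thesis
  proof (induction "Polynomial.degree p" arbitrary: p)
    case 0
    then obtain a where "p = [:a:]" by (metis degree_eq_zeroE)
    with 0 v show ?case by (simp add: poly_apply_pCons poly_apply_0)
  next
    case (Suc d)
    then have "\<not> constant (poly p)"
      by (simp add: constant_degree)
    then obtain l where "poly p l = 0"
      using fundamental_theorem_of_algebra by blast
    then obtain q where q: "p = [:- l, 1:] * q"
      by (auto simp: poly_eq_0_iff_dvd)
    then have "q \<noteq> 0" using Suc.prems by auto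
    have "p = Polynomial.smult (- l) q + pCons 0 q" using q by simp
    then have eq: "poly_apply p M v = (- l) *s poly_apply q M v + M *v poly_apply q M v"
      by (simp only: poly_apply_add poly_apply_smult poly_apply_pCons) simp
    show ?case
    proof (cases "poly_apply q M v = 0")
      case True
      have "Polynomial.degree p = Suc (Polynomial.degree q)"
        using \<open>q \<noteq> 0\<close> unfolding q by (subst degree_mult_eq) simp_all
      then show ?thesis
        using Suc.hyps True \<open>q \<noteq> 0\<close> by simp
    next
      case False
      moreover have "M *v poly_apply q M v = l *s poly_apply q M v"
        using eq Suc.prems(2) by (simp add: vec.scale_minus_left add_eq_0_iff)
      ultimately show ?thesis using in_S by blast
    qed
  qed
qed

lemma exp_eigenvector:
  fixes M :: "(complex, 'n::finite) sqmat"
  assumes "mat_of M *v v = l *s v"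
  shows "mat_of (exp M) *v v = exp l *s v"
proof -
  have pow: "mat_of (M ^ k) *v v = l ^ k *s v" for k
  proof (induction k)
    case (Suc k)
    have "mat_of (M ^ Suc k) *v v = mat_of M *v (mat_of (M ^ k) *v v)"
      by (simp add: times_sqmat.rep_eq matrix_vector_mul_assoc)
    then show ?case
      by (simp add: Suc vector_scalar_commute assms vector_smult_assoc mult.commute)
  qed (simp add: one_sqmat.rep_eq)
  have "(mat_of (exp M) *v v) $ i = exp l * v $ i" for i
  proof -
    define h where "h N = (mat_of N *v v) $ i" for N :: "(complex, 'n) sqmat"
    have "bounded_linear h"
      unfolding h_def matrix_vector_mult_def vec_lambda_beta
      by (intro bounded_linear_sum bounded_linear_mult_left[THEN bounded_linear_compose] bounded_linear_entry)
    then have "h (exp M) = (\<Sum>k. h (M ^ k /\<^sub>R fact k))"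
      unfolding exp_def by (rule bounded_linear.suminf[OF _ summable_exp_generic])
    also have "\<dots> = (\<Sum>k. l ^ k /\<^sub>R fact k * v $ i)"
      using \<open>bounded_linear h\<close>[THEN bounded_linear.linear, THEN linear_scale]
      by (simp add: h_def pow)
    also have "\<dots> = exp l * v $ i"
      unfolding exp_def by (rule suminf_mult2[OF summable_exp_generic, symmetric])
    finally show ?thesis by (simp add: h_def)
  qed
  then show ?thesis by (simp add: vec_eq_iff)
qed

text \<open>\<open>M\<close> commutes with \<open>exp M\<close>, hence leaves its eigenspace for
  \<open>\<mu>\<close> invariant and has an eigenvector there.\<close>

lemma eigenvector_of_exp:
  fixes M :: "(complex, 'n::finite) sqmat"
  assumes "mat_of (exp M) *v v = \<mu> *s v" "v \<noteq> 0"
  shows "\<exists>w l. w \<noteq> 0 \<and> mat_of M *v w = l *s w \<and> exp l = \<mu>"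
proof -
  let ?S = "{w. mat_of (exp M) *v w = \<mu> *s w}"
  have "mat_of (exp M) *v (mat_of M *v u) = mat_of M *v (mat_of (exp M) *v u)" for u
    by (simp add: matrix_vector_mul_assoc flip: times_sqmat.rep_eq exp_times_arg_commute)
  then obtain w l where w: "w \<in> ?S" "w \<noteq> 0" "mat_of M *v w = l *s w"
    using eigenvector_in_invariant_subspace[of ?S "mat_of M" v] assms
    by (auto simp: matrix_vector_right_distrib vec.scale_right_distrib vector_scalar_commute vector_smult_assoc mult.commute)
  then have "exp l *s w = \<mu> *s w"
    using exp_eigenvector[OF w(3)] by simp
  then have "exp l = \<mu>" using w(2) by (simp only: vec.scale_cancel_right) simp
  with w show ?thesis by blast
qed

section \<open>Hamiltonian matrices\<close>

definition cinner :: "complex ^ 'n \<Rightarrow> complex ^ 'n \<Rightarrow> complex" where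
  "cinner u w = (\<Sum>i\<in>UNIV. cnj (u $ i) * w $ i)"

lemma cinner_add_right: "cinner u (v + w) = cinner u v + cinner u w"
  and cinner_diff_right: "cinner u (v - w) = cinner u v - cinner u w"
  and cinner_diff_left: "cinner (u - v) w = cinner u w - cinner v w"
  and cinner_minus_right: "cinner u (- w) = - cinner u w"
  and cinner_scale_right: "cinner u (c *s w) = c * cinner u w"
  and cinner_0_right: "cinner u 0 = 0"
  and cinner_0_left: "cinner 0 w = 0"
  by (simp_all add: cinner_def sum.distrib sum_subtractf sum_negf distrib_left distrib_right
      left_diff_distrib right_diff_distrib sum_distrib_left mult.left_commute)

lemma cnj_cinner: "cnj (cinner u w) = cinner w u"
  by (simp add: cinner_def mult.commute)

lemma cinner_mult_right: "cinner u (M *v w) = cinner (conj_transpose M *v u) w"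
proof -
  have "cinner u (M *v w) = (\<Sum>i\<in>UNIV. \<Sum>j\<in>UNIV. cnj (u $ i) * (M $ i $ j * w $ j))"
    by (simp add: cinner_def matrix_vector_mult_def sum_distrib_left)
  also have "\<dots> = (\<Sum>j\<in>UNIV. \<Sum>i\<in>UNIV. cnj (u $ i) * (M $ i $ j * w $ j))"
    by (rule sum.swap)
  also have "\<dots> = cinner (conj_transpose M *v u) w"
    by (simp add: cinner_def matrix_vector_mult_def conj_transpose_def sum_distrib_right sum_distrib_left mult_ac)
  finally show ?thesis .
qed

lemma cinner_self: "cinner u u = of_real (\<Sum>i\<in>UNIV. (cmod (u $ i))\<^sup>2)"
  by (simp add: cinner_def complex_norm_square mult.commute del: of_real_power)

lemma cinner_self_nonneg: "0 \<le> Re (cinner u u)"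
  by (simp add: cinner_self sum_nonneg)

lemma cinner_self_eq_0: "Re (cinner u u) = 0 \<Longrightarrow> u = 0"
  by (simp add: cinner_self sum_nonneg_eq_0_iff vec_eq_iff)

lemma conj_transpose_conj_transpose [simp]: "conj_transpose (conj_transpose M) = M"
  by (simp add: conj_transpose_def vec_eq_iff)

lemma conj_transpose_mult: "conj_transpose (M ** N) = conj_transpose N ** conj_transpose M"
  by (simp add: conj_transpose_def vec_eq_iff matrix_matrix_mult_def mult.commute)

lemma conj_transpose_add: "conj_transpose (M + N) = conj_transpose M + conj_transpose N"
  and conj_transpose_diff: "conj_transpose (M - N) = conj_transpose M - conj_transpose N"
  and conj_transpose_minus: "conj_transpose (- M) = - conj_transpose M"
  and conj_transpose_one: "conj_transpose (mat 1) = mat 1"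
  by (auto simp: conj_transpose_def vec_eq_iff mat_def)

lemma conj_transpose_eqI:
  assumes "\<And>u w. cinner u (M *v w) = cinner (M *v u) w"
  shows "conj_transpose M = M"
proof -
  have "(conj_transpose M *v u - M *v u) = 0" for u
  proof -
    let ?d = "conj_transpose M *v u - M *v u"
    have "cinner ?d ?d = 0"
      using assms[of u ?d] by (simp add: cinner_mult_right cinner_diff_left)
    then show ?thesis using cinner_self_eq_0[of ?d] by simp
  qed
  then show ?thesis by (simp add: matrix_eq)
qed

lemma det_eq_0_iff_kernel:
  fixes M :: "complex ^ 'n ^ 'n"
  shows "det M = 0 \<longleftrightarrow> (\<exists>v. v \<noteq> 0 \<and> M *v v = 0)"
proof -
  have "det M \<noteq> 0 \<longleftrightarrow> (\<exists>N. N ** M = mat 1)"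
    unfolding invertible_det_nz[symmetric] by (rule invertible_left_inverse)
  then show ?thesis
    unfolding matrix_left_invertible_ker by blast
qed

lemma det_conj_transpose: "det (conj_transpose M) = cnj (det M)"
proof -
  have "det (conj_transpose M) = det (transpose (\<chi> i j. cnj (M $ i $ j)))"
    by (simp add: conj_transpose_def transpose_def)
  also have "\<dots> = cnj (det M)"
    unfolding det_transpose by (simp add: det_def)
  finally show ?thesis .
qed

text \<open>The determinants of \<open>conj_transpose M - mat l\<close> and
  \<open>M - mat (cnj l)\<close> are conjugate.\<close>

lemma mat_eigenvalue_conj_transpose:
  assumes "conj_transpose M *v y = l *s y" "y \<noteq> 0"
  shows "mat_eigenvalue M (cnj l)"
proof -
  have scal: "(N - mat c) *v v = N *v v - c *s v" for N :: "complex ^ 'n ^ 'n" and c v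
    by (simp add: vec_eq_iff matrix_vector_mult_def mat_def left_diff_distrib sum_subtractf
        if_distrib[of "\<lambda>x. x * _"] cong: if_cong)
  have "(conj_transpose M - mat l) *v y = 0"
    using assms(1) by (simp add: scal)
  then have "det (conj_transpose M - mat l) = 0"
    using assms(2) det_eq_0_iff_kernel by blast
  moreover have "conj_transpose M - mat l = conj_transpose (M - mat (cnj l))"
    by (auto simp: conj_transpose_def vec_eq_iff mat_def)
  ultimately have "det (M - mat (cnj l)) = 0"
    by (simp add: det_conj_transpose)
  then show ?thesis
    unfolding det_eq_0_iff_kernel scal mat_eigenvalue_def by auto
qed

text \<open>The necessary half of the Hautus test: no feedback acts on a left eigenvector that
  \<open>B\<close> annihilates, so its eigenvalue persists in every
  \<open>A + B ** F\<close>.\<close>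

lemma stabilizable_no_unstable_left_eigenvector:
  assumes "stabilizable A B" "conj_transpose A *v y = l *s y" "conj_transpose B *v y = 0" "0 \<le> Re l"
  shows "y = 0"
proof (rule ccontr)
  assume "y \<noteq> 0"
  obtain F where F: "\<And>l. mat_eigenvalue (A + B ** F) l \<Longrightarrow> Re l < 0"
    using assms(1) unfolding stabilizable_def by blast
  have "conj_transpose (A + B ** F) *v y = l *s y"
    using assms(2,3)
    by (simp add: conj_transpose_add conj_transpose_mult matrix_vector_mult_add_rdistrib
        flip: matrix_vector_mul_assoc)
  then have "Re (cnj l) < 0"
    using F mat_eigenvalue_conj_transpose \<open>y \<noteq> 0\<close> by blast
  with assms(4) show False by simp
qed

section \<open>Block matrices over a doubled index type\<close>

definition block :: "'a ^ 'n::finite ^ 'n \<Rightarrow> 'a ^ 'n ^ 'n \<Rightarrow> 'a ^ 'n ^ 'n \<Rightarrow> 'a ^ 'n ^ 'n \<Rightarrow> 'a ^ ('n + 'n) ^ ('n + 'n)" where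
  "block A B C D = (\<chi> i j. case i of
      Inl a \<Rightarrow> (case j of Inl b \<Rightarrow> A $ a $ b | Inr b \<Rightarrow> B $ a $ b)
    | Inr a \<Rightarrow> (case j of Inl b \<Rightarrow> C $ a $ b | Inr b \<Rightarrow> D $ a $ b))"

definition join :: "'a ^ 'n::finite \<Rightarrow> 'a ^ 'n \<Rightarrow> 'a ^ ('n + 'n)" where
  "join x y = (\<chi> i. case i of Inl a \<Rightarrow> x $ a | Inr a \<Rightarrow> y $ a)"

lemma block_nth [simp]:
  "block A B C D $ Inl i $ Inl j = A $ i $ j" "block A B C D $ Inl i $ Inr j = B $ i $ j"
  "block A B C D $ Inr i $ Inl j = C $ i $ j" "block A B C D $ Inr i $ Inr j = D $ i $ j"
  by (simp_all add: block_def)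

lemma join_nth [simp]: "join x y $ Inl i = x $ i" "join x y $ Inr i = y $ i"
  by (simp_all add: join_def)

lemma all_sum_iff: "(\<forall>i :: 'n + 'm. P i) \<longleftrightarrow> (\<forall>i. P (Inl i)) \<and> (\<forall>i. P (Inr i))"
  by (metis sum.exhaust)

lemma sum_over_sum: "(\<Sum>i\<in>(UNIV :: ('n::finite + 'm::finite) set). f i) = (\<Sum>i\<in>UNIV. f (Inl i)) + (\<Sum>i\<in>UNIV. f (Inr i))"
  unfolding UNIV_Plus_UNIV[symmetric] by (subst sum.Plus) simp_all

lemma block_eq_iff: "block A B C D = block A' B' C' D' \<longleftrightarrow> A = A' \<and> B = B' \<and> C = C' \<and> D = D'"
  by (auto simp: vec_eq_iff all_sum_iff)

lemma join_eq_iff: "join x y = join x' y' \<longleftrightarrow> x = x' \<and> y = y'"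
  by (auto simp: vec_eq_iff all_sum_iff)

lemma block_exhaust: "\<exists>A B C D. M = block A B C D"
  by (intro exI[of _ "\<chi> i j. M $ Inl i $ Inl j"] exI[of _ "\<chi> i j. M $ Inl i $ Inr j"]
      exI[of _ "\<chi> i j. M $ Inr i $ Inl j"] exI[of _ "\<chi> i j. M $ Inr i $ Inr j"])
    (simp add: vec_eq_iff all_sum_iff)

lemma join_exhaust: "\<exists>x y. v = join x y"
  by (intro exI[of _ "\<chi> i. v $ Inl i"] exI[of _ "\<chi> i. v $ Inr i"]) (simp add: vec_eq_iff all_sum_iff)

lemma block_mult: "block A B C D ** block A' B' C' D' =
    block (A ** A' + B ** C') (A ** B' + B ** D') (C ** A' + D ** C') (C ** B' + D ** D')"
  by (simp add: vec_eq_iff all_sum_iff matrix_matrix_mult_def sum_over_sum)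

lemma block_mult_join: "block A B C D *v join x y = join (A *v x + B *v y) (C *v x + D *v y)"
  by (simp add: vec_eq_iff all_sum_iff matrix_vector_mult_def sum_over_sum)

lemma block_diff: "block A B C D - block A' B' C' D' = block (A - A') (B - B') (C - C') (D - D')"
  and block_minus: "- block A B C D = block (- A) (- B) (- C) (- D)"
  by (simp_all add: vec_eq_iff all_sum_iff)

lemma join_add: "join x y + join x' y' = join (x + x') (y + y')"
  and join_diff: "join x y - join x' y' = join (x - x') (y - y')"
  and join_scale: "c *s join x y = join (c *s x) (c *s y)"
  and join_0: "join 0 0 = 0"
  by (simp_all add: vec_eq_iff all_sum_iff)

lemma mat_1_block: "mat 1 = block (mat 1) 0 0 (mat 1)"
  by (auto simp: vec_eq_iff all_sum_iff mat_def)

lemma conj_transpose_block: "conj_transpose (block A B C D) =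
    block (conj_transpose A) (conj_transpose C) (conj_transpose B) (conj_transpose D)"
  by (simp add: vec_eq_iff all_sum_iff conj_transpose_def)

lemma gelfand_mat_block: "gelfand_mat (block A B C D) \<phi> =
    block (gelfand_mat A \<phi>) (gelfand_mat B \<phi>) (gelfand_mat C \<phi>) (gelfand_mat D \<phi>)"
  by (simp add: vec_eq_iff all_sum_iff gelfand_mat_def)

lemma cinner_join: "cinner (join x y) (join x' y') = cinner x x' + cinner y y'"
  by (simp add: cinner_def sum_over_sum)

section \<open>The Hamiltonian and its stable subspace\<close>

definition hamiltonian :: "complex ^ 'n::finite ^ 'n \<Rightarrow> complex ^ 'm ^ 'n \<Rightarrow> complex ^ 'n ^ 'p \<Rightarrow> complex ^ ('n + 'n) ^ ('n + 'n)" where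
  "hamiltonian A B C = block A (- (B ** conj_transpose B)) (- (conj_transpose C ** C)) (- conj_transpose A)"

lemma matrix_vector_mult_minus_left: "(- M) *v v = - (M *v v)" for M :: "'a::ring_1 ^ 'n ^ 'm"
  by (simp add: vec_eq_iff matrix_vector_mult_def sum_negf)

lemma hamiltonian_mult_join: "hamiltonian A B C *v join x y =
    join (A *v x - B *v (conj_transpose B *v y)) (- (conj_transpose C *v (C *v x)) - conj_transpose A *v y)"
  by (simp add: hamiltonian_def block_mult_join matrix_vector_mult_minus_left matrix_vector_mul_assoc)

text \<open>Pair the first row with \<open>y\<close> and the second with \<open>x\<close>. Since
  \<open>cnj l = - l\<close> on the imaginary axis, the conjugate of the first pairing cancels
  against the second and leaves the squared norms of \<open>b\<close> and \<open>c\<close> with sum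
  0. The Hautus test then excludes \<open>x\<close> by detectability and \<open>y\<close> by
  stabilizability.\<close>

lemma hamiltonian_no_imaginary_eigenvalue:
  assumes "stabilizable A B" "detectable A C" "hamiltonian A B C *v v = l *s v" "Re l = 0"
  shows "v = 0"
proof -
  obtain x y where v: "v = join x y" using join_exhaust by blast
  define b where "b = conj_transpose B *v y"
  define c where "c = C *v x"
  have 1: "A *v x - B *v b = l *s x" and 2: "- (conj_transpose C *v c) - conj_transpose A *v y = l *s y"
    using assms(3) by (simp_all add: v hamiltonian_mult_join join_scale join_eq_iff b_def c_def)
  have "cinner y (A *v x) - cinner b b = l * cinner y x"
    using arg_cong[OF 1, of "cinner y"]
    by (simp add: cinner_diff_right cinner_scale_right cinner_mult_right[of y B] b_def)
  from arg_cong[OF this, of cnj] have e1: "cinner (A *v x) y - cinner b b = - l * cinner x y"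
    using assms(4) by (simp add: cnj_cinner complex_eq_iff)
  have e2: "- cinner c c - cinner (A *v x) y = l * cinner x y"
    using arg_cong[OF 2, of "cinner x"]
    by (simp add: cinner_diff_right cinner_minus_right cinner_scale_right cinner_mult_right[of x] c_def)
  have "- (cinner b b + cinner c c) =
      (cinner (A *v x) y - cinner b b) + (- cinner c c - cinner (A *v x) y)"
    by simp
  also have "\<dots> = 0"
    unfolding e1 e2 by simp
  finally have "cinner b b + cinner c c = 0"
    by (simp only: neg_equal_0_iff_equal)
  then have "Re (cinner b b) + Re (cinner c c) = 0"
    by (metis plus_complex.simps(1) zero_complex.simps(1))
  then have bc: "b = 0" "c = 0"
    using cinner_self_nonneg[of b] cinner_self_nonneg[of c] by (auto intro!: cinner_self_eq_0)
  have "x = 0"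
    using assms(2) 1 bc assms(4)
    by (intro stabilizable_no_unstable_left_eigenvector[of "conj_transpose A" "conj_transpose C" x l])
      (auto simp: detectable_def c_def)
  moreover have "conj_transpose A *v y = (- l) *s y"
    using 2 bc by (simp add: vec.scale_minus_left minus_equation_iff[of "conj_transpose A *v y"])
  then have "y = 0"
    using assms(1,4) bc(1)
    by (intro stabilizable_no_unstable_left_eigenvector[of A B y "- l"]) (simp_all add: b_def)
  ultimately show ?thesis by (simp add: v join_0)
qed

definition symplectic :: "complex ^ ('n::finite + 'n) ^ ('n + 'n)" where
  "symplectic = block 0 (mat 1) (- mat 1) 0"

text \<open>The assumption \<open>symplectic\<close> reflects that conjugation by the symplectic
  matrix sends the Hamiltonian to minus its adjoint, and thereby its stable projection to the
  complement of the adjoint projection.\<close>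

locale hamiltonian_projection =
  fixes A :: "complex ^ 'n ^ 'n" and B :: "complex ^ 'm ^ 'n" and C :: "complex ^ 'n ^ 'p"
    and Q :: "complex ^ ('n::finite + 'n) ^ ('n + 'n)"
  assumes stabilizable: "stabilizable A B"
    and idempotent: "Q ** Q = Q"
    and commute: "hamiltonian A B C ** Q = Q ** hamiltonian A B C"
    and symplectic: "symplectic ** Q = (mat 1 - conj_transpose Q) ** symplectic"
    and stable: "\<And>v l. v \<noteq> 0 \<Longrightarrow> hamiltonian A B C *v v = l *s v \<Longrightarrow> Q *v v = v \<Longrightarrow> Re l < 0"
begin

text \<open>On the range of \<open>Q\<close>, the assumption \<open>symplectic\<close> lets a factor
  \<open>1 - Q\<close> be moved to the other argument of the symplectic form, where it gives
  0.\<close>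

lemma isotropic:
  assumes "Q *v join x y = join x y" "Q *v join x' y' = join x' y'"
  shows "cinner x y' = cinner y x'"
proof -
  let ?v = "join x y" and ?w = "join x' y'"
  have "cinner ?v (symplectic *v ?w) = cinner ?v ((symplectic ** Q) *v ?w)"
    using assms(2) by (simp flip: matrix_vector_mul_assoc)
  also have "\<dots> = cinner ((mat 1 - Q) *v ?v) (symplectic *v ?w)"
    by (simp add: symplectic cinner_mult_right conj_transpose_diff conj_transpose_one
        flip: matrix_vector_mul_assoc)
  also have "(mat 1 - Q) *v ?v = 0"
    using assms(1) by (simp add: matrix_vector_mult_diff_rdistrib)
  finally show ?thesis
    by (simp add: symplectic_def block_mult_join cinner_join cinner_0_left
        matrix_vector_mult_minus_left cinner_minus_right)
qed

lemma range_invariant: "Q *v v = v \<Longrightarrow> Q *v (hamiltonian A B C *v v) = hamiltonian A B C *v v"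
  by (metis commute matrix_vector_mul_assoc)

text \<open>This makes the range a graph. Isotropy of \<open>(0, u)\<close> and its image under the
  Hamiltonian forces \<open>conj_transpose B *v u = 0\<close>. The vertical part is then invariant
  under \<open>conj_transpose A\<close>; an eigenvalue \<open>l\<close> there is the eigenvalue
  \<open>- l\<close> of the Hamiltonian, so \<open>Re l > 0\<close>, against the Hautus
  test.\<close>

lemma range_inter_vertical:
  assumes "Q *v join 0 y = join 0 y"
  shows "y = 0"
proof (rule ccontr)
  assume "y \<noteq> 0"
  let ?S = "{y. Q *v join 0 y = join 0 y}"
  have B0: "conj_transpose B *v u = 0" if u: "u \<in> ?S" for u
  proof -
    let ?b = "conj_transpose B *v u"
    have "hamiltonian A B C *v join 0 u = join (- (B *v ?b)) (- (conj_transpose A *v u))"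
      by (simp add: hamiltonian_mult_join)
    then have "Q *v join (- (B *v ?b)) (- (conj_transpose A *v u)) = join (- (B *v ?b)) (- (conj_transpose A *v u))"
      using range_invariant[of "join 0 u"] u by simp
    from isotropic[OF _ this, of 0 u] u have "cinner u (B *v ?b) = 0"
      by (simp add: cinner_0_left cinner_minus_right)
    then have "cinner ?b ?b = 0"
      by (simp add: cinner_mult_right[of u B])
    then show ?thesis using cinner_self_eq_0[of ?b] by simp
  qed
  have H: "hamiltonian A B C *v join 0 u = (- 1) *s join 0 (conj_transpose A *v u)" if "u \<in> ?S" for u
    using B0[OF that] by (simp add: hamiltonian_mult_join join_scale vec.scale_minus_left)
  have "conj_transpose A *v u \<in> ?S" if u: "u \<in> ?S" for u
    using range_invariant[of "join 0 u"] u H[OF u]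
    by (simp add: vec.scale_minus_left vec.neg)
  moreover have "u + w \<in> ?S" if "u \<in> ?S" "w \<in> ?S" for u w
    using that join_add[of 0 u 0 w] by (simp add: matrix_vector_right_distrib) (metis matrix_vector_right_distrib)
  moreover have "c *s u \<in> ?S" if "u \<in> ?S" for c u
    using that join_scale[of c 0 u] by simp (metis vector_scalar_commute)
  ultimately obtain w l where w: "w \<in> ?S" "w \<noteq> 0" "conj_transpose A *v w = l *s w"
    using eigenvector_in_invariant_subspace[of ?S "conj_transpose A" y] assms \<open>y \<noteq> 0\<close> by blast
  have "join 0 w \<noteq> 0"
    using w(2) join_eq_iff[of 0 w 0 0] by (simp add: join_0)
  moreover have "hamiltonian A B C *v join 0 w = (- l) *s join 0 w"
    using H[OF w(1)] w(3) by (simp add: join_scale vec.scale_minus_left)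
  ultimately have "Re (- l) < 0"
    using stable w(1) by blast
  then show False
    using stabilizable_no_unstable_left_eigenvector[OF stabilizable w(3) B0[OF w(1)]] w(2) by simp
qed

end

section \<open>The Riccati equation and the Lyapunov inequality\<close>

lemma matrix_mult_minus_left: "(- M) ** N = - (M ** N)" for M :: "'a::ring_1 ^ 'n ^ 'm"
  by (simp add: vec_eq_iff matrix_matrix_mult_def sum_negf)

lemma matrix_mult_minus_right: "M ** (- N) = - (M ** N)" for M :: "'a::ring_1 ^ 'n ^ 'm"
  by (simp add: vec_eq_iff matrix_matrix_mult_def sum_negf)

lemma matrix_diff_ldistrib: "M ** (N - N') = M ** N - M ** N'" for M :: "'a::ring_1 ^ 'n ^ 'm"
  by (simp add: vec_eq_iff matrix_matrix_mult_def right_diff_distrib sum_subtractf)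

context hamiltonian_projection
begin

lemma block_symmetry:
  assumes "Q = block Q11 Q12 Q21 Q22"
  shows "conj_transpose Q12 = Q12" "conj_transpose Q11 = mat 1 - Q22"
proof -
  have "block Q21 Q22 (- Q11) (- Q12) = block (conj_transpose Q21) (mat 1 - conj_transpose Q11)
      (- (mat 1 - conj_transpose Q22)) (- conj_transpose Q12)"
    using symplectic unfolding assms symplectic_def conj_transpose_block mat_1_block[where 'b = 'n] block_diff block_mult
    by (simp add: matrix_mult_minus_left matrix_mult_minus_right)
  then show "conj_transpose Q12 = Q12" "conj_transpose Q11 = mat 1 - Q22"
    by (auto simp: block_eq_iff)
qed

text \<open>By \<open>block_symmetry\<close> this is the Gram matrix of the block row \<open>[Q11, Q12]\<close>.\<close>

lemma gram_kernel:
  assumes Q: "Q = block Q11 Q12 Q21 Q22"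
    and "(Q12 ** Q12 + Q11 ** (mat 1 - Q22)) *v y = 0"
  shows "y = 0"
proof -
  note sym = block_symmetry[OF Q]
  have "cinner y ((Q12 ** Q12 + Q11 ** (mat 1 - Q22)) *v y)
      = cinner (Q12 *v y) (Q12 *v y) + cinner ((mat 1 - Q22) *v y) ((mat 1 - Q22) *v y)"
    by (simp add: matrix_vector_mult_add_rdistrib cinner_add_right sym
        cinner_mult_right[of y Q12] cinner_mult_right[of y Q11] flip: matrix_vector_mul_assoc)
  then have "Re (cinner (Q12 *v y) (Q12 *v y)) + Re (cinner ((mat 1 - Q22) *v y) ((mat 1 - Q22) *v y)) = 0"
    using assms(2) by (metis cinner_0_right plus_complex.simps(1) zero_complex.simps(1))
  \<comment> \<open>Both squared norms vanish, which says exactly that \<open>Q\<close> fixes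
    \<open>(0, y)\<close>.\<close>
  then have "Q12 *v y = 0" "(mat 1 - Q22) *v y = 0"
    using cinner_self_nonneg[of "Q12 *v y"] cinner_self_nonneg[of "(mat 1 - Q22) *v y"]
    by (auto intro!: cinner_self_eq_0)
  then have "Q *v join 0 y = join 0 y"
    by (simp add: Q block_mult_join matrix_vector_mult_diff_rdistrib)
  then show ?thesis by (rule range_inter_vertical)
qed

text \<open>The entries of \<open>?z\<close> below are the adjoints of \<open>Q11\<close> and
  \<open>Q12\<close> applied to \<open>R *v x\<close>. So the first half of \<open>Q *v ?z\<close>
  is the Gram matrix times \<open>R *v x\<close>, that is \<open>x\<close>, and the second half
  defines \<open>P\<close>: the range contains the graph of \<open>P\<close>.\<close>

lemma riccati:
  assumes Q: "Q = block Q11 Q12 Q21 Q22"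
    and inv: "(Q12 ** Q12 + Q11 ** (mat 1 - Q22)) ** R = mat 1"
  defines "P \<equiv> (Q21 ** (mat 1 - Q22) + Q22 ** Q12) ** R"
  shows riccati_hermitian: "conj_transpose P = P"
    and riccati_equation: "P ** (B ** conj_transpose B) ** P - P ** A - conj_transpose A ** P - conj_transpose C ** C = 0"
    and riccati_stable: "\<And>v l. v \<noteq> 0 \<Longrightarrow> (A - B ** conj_transpose B ** P) *v v = l *s v \<Longrightarrow> Re l < 0"
proof -
  have graph: "Q *v join x (P *v x) = join x (P *v x)" for x
  proof -
    let ?z = "join ((mat 1 - Q22) *v (R *v x)) (Q12 *v (R *v x))"
    have "Q *v ?z = join ((Q12 ** Q12 + Q11 ** (mat 1 - Q22)) *v (R *v x)) (P *v x)"
      by (simp add: Q P_def block_mult_join matrix_vector_mult_add_rdistrib add.commute flip: matrix_vector_mul_assoc)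
    also have "(Q12 ** Q12 + Q11 ** (mat 1 - Q22)) *v (R *v x) = x"
      by (simp add: inv matrix_vector_mul_assoc)
    finally have "Q *v ?z = join x (P *v x)" .
    then show ?thesis
      by (metis idempotent matrix_vector_mul_assoc)
  qed
  show "conj_transpose P = P"
    by (rule conj_transpose_eqI) (rule isotropic[OF graph graph])
  define K where "K = A - B ** conj_transpose B ** P"
  define N where "N = - (conj_transpose C ** C) - conj_transpose A ** P"
  have H: "hamiltonian A B C *v join x (P *v x) = join (K *v x) (N *v x)" for x
    by (simp add: hamiltonian_mult_join K_def N_def matrix_vector_mult_diff_rdistrib
        matrix_vector_mult_minus_left flip: matrix_vector_mul_assoc)
  \<comment> \<open>The range contains \<open>(K x, N x)\<close> by invariance and
    \<open>(K x, P K x)\<close> as a point of the graph. Their difference is vertical, hence 0, and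
    \<open>N = P ** K\<close> is the Riccati equation.\<close>
  have N: "N *v x = P *v (K *v x)" for x
  proof -
    have "join 0 (N *v x - P *v (K *v x)) = join (K *v x) (N *v x) - join (K *v x) (P *v (K *v x))"
      by (simp add: join_diff)
    then have "Q *v join 0 (N *v x - P *v (K *v x)) = join 0 (N *v x - P *v (K *v x))"
      using range_invariant[OF graph[of x]] graph[of "K *v x"]
      by (simp add: H matrix_vector_mult_diff_distrib)
    then show ?thesis
      using range_inter_vertical by fastforce
  qed
  then have "N = P ** K"
    by (simp add: matrix_eq flip: matrix_vector_mul_assoc)
  moreover have "P ** K = P ** A - P ** (B ** conj_transpose B) ** P"
    by (simp add: K_def matrix_diff_ldistrib matrix_mul_assoc)
  ultimately show "P ** (B ** conj_transpose B) ** P - P ** A - conj_transpose A ** P - conj_transpose C ** C = 0"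
    by (simp add: N_def algebra_simps)
  fix v l assume v: "v \<noteq> 0" "(A - B ** conj_transpose B ** P) *v v = l *s v"
  have "join v (P *v v) \<noteq> 0"
    using v(1) join_eq_iff[of v "P *v v" 0 0] by (auto simp: join_0)
  moreover have "hamiltonian A B C *v join v (P *v v) = l *s join v (P *v v)"
    using v(2) by (simp add: H N K_def[symmetric] join_scale vector_scalar_commute)
  ultimately show "Re l < 0"
    using stable graph by blast
qed

end

section \<open>Adjoints and passage to the limit projection\<close>

definition conj_transpose_sqmat :: "(complex, 'n::finite) sqmat \<Rightarrow> (complex, 'n) sqmat" where
  "conj_transpose_sqmat M = Sqmat (conj_transpose (mat_of M))"

lemma mat_of_conj_transpose_sqmat: "mat_of (conj_transpose_sqmat M) = conj_transpose (mat_of M)"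
  by (simp add: conj_transpose_sqmat_def Sqmat_inverse)

lemma conj_transpose_sqmat_mult:
  "conj_transpose_sqmat (M * N) = conj_transpose_sqmat N * conj_transpose_sqmat M"
  by (simp add: mat_of_inject[symmetric] mat_of_conj_transpose_sqmat times_sqmat.rep_eq conj_transpose_mult)

lemma conj_transpose_sqmat_one: "conj_transpose_sqmat 1 = 1"
  by (simp add: mat_of_inject[symmetric] mat_of_conj_transpose_sqmat one_sqmat.rep_eq conj_transpose_one)

lemma conj_transpose_sqmat_power: "conj_transpose_sqmat (M ^ k) = conj_transpose_sqmat M ^ k"
  by (induction k) (simp_all add: conj_transpose_sqmat_one conj_transpose_sqmat_mult power_commutes)

text \<open>Transposition exchanges row and column sums, so the bound is the coarse one from adding
  up all entries.\<close>

lemma bounded_linear_conj_transpose_sqmat: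
  "bounded_linear (conj_transpose_sqmat :: (complex, 'n::finite) sqmat \<Rightarrow> _)"
proof (rule bounded_linear_intro[of _ "real CARD('n) * real CARD('n)"])
  fix M N :: "(complex, 'n) sqmat" and r
  show "conj_transpose_sqmat (M + N) = conj_transpose_sqmat M + conj_transpose_sqmat N"
    by (simp add: mat_of_inject[symmetric] mat_of_conj_transpose_sqmat plus_sqmat.rep_eq conj_transpose_add)
  show "conj_transpose_sqmat (r *\<^sub>R M) = r *\<^sub>R conj_transpose_sqmat M"
    unfolding mat_of_inject[symmetric]
    by (simp add: mat_of_conj_transpose_sqmat scaleR_sqmat.rep_eq)
      (simp add: vec_eq_iff conj_transpose_def)
  have "norm (conj_transpose_sqmat M) \<le> (\<Sum>i\<in>(UNIV::'n set). \<Sum>j\<in>(UNIV::'n set). norm M)"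
  proof (rule order_trans[OF norm_sqmat_le_sum], intro sum_mono)
    fix i j
    show "norm (mat_of (conj_transpose_sqmat M) $ i $ j) \<le> norm M"
      using entry_le_row_sum_norm[of "mat_of M" j i]
      by (simp add: mat_of_conj_transpose_sqmat norm_sqmat.rep_eq) (simp add: conj_transpose_def)
  qed
  then show "norm (conj_transpose_sqmat M) \<le> norm M * (real CARD('n) * real CARD('n))"
    by (simp add: mult_ac)
qed

lemma conj_transpose_sqmat_exp: "conj_transpose_sqmat (exp M) = exp (conj_transpose_sqmat M)"
  by (rule exp_power_hom[OF bounded_linear_conj_transpose_sqmat conj_transpose_sqmat_power])

lemma tendsto_mult_vec:
  fixes f :: "'b \<Rightarrow> (complex, 'n::finite) sqmat"
  assumes "(f \<longlongrightarrow> L) F"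
  shows "((\<lambda>k. mat_of (f k) *v v) \<longlongrightarrow> mat_of L *v v) F"
  unfolding matrix_vector_mult_def
  by (intro tendsto_vec_lambda tendsto_sum tendsto_mult tendsto_const
      bounded_linear.tendsto[OF bounded_linear_entry assms])

text \<open>Commutation and the symplectic relation already hold for each \<open>s m\<close>, being
  an inverse of \<open>1 - exp H ^ 2 ^ m\<close>, and pass to the limit.\<close>

lemma hamiltonian_projection_limit:
  fixes A :: "complex ^ 'n ^ 'n" and B :: "complex ^ 'm ^ 'n" and C :: "complex ^ 'n ^ 'p"
    and Q :: "(complex, 'n + 'n) sqmat"
  assumes stab: "stabilizable A B" "detectable A C"
    and lim: "s \<longlonglongrightarrow> Q" and idem: "Q * Q = Q"
    and inv: "\<And>m. (1 - exp (Sqmat (hamiltonian A B C)) ^ 2 ^ m) * s m = 1"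
      "\<And>m. s m * (1 - exp (Sqmat (hamiltonian A B C)) ^ 2 ^ m) = 1"
  shows "hamiltonian_projection A B C (mat_of Q)"
proof
  define H where "H = Sqmat (hamiltonian A B C)"
  have mat_of_H: "mat_of H = hamiltonian A B C" by (simp add: H_def Sqmat_inverse)
  note inv = inv[folded H_def]
  show "stabilizable A B" by fact
  show "mat_of Q ** mat_of Q = mat_of Q"
    using idem by (simp flip: times_sqmat.rep_eq)
  have "H * exp H ^ k = exp H ^ k * H" for k
  proof (induction k)
    case (Suc k)
    have "H * exp H ^ Suc k = (H * exp H) * exp H ^ k"
      by (simp add: mult.assoc)
    also have "\<dots> = exp H * (H * exp H ^ k)"
      by (simp add: exp_times_arg_commute[symmetric] mult.assoc)
    also have "\<dots> = exp H ^ Suc k * H"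
      by (simp add: Suc mult.assoc)
    finally show ?case .
  qed simp
  then have comm: "(1 - exp H ^ k) * H = H * (1 - exp H ^ k)" for k
    by (simp add: algebra_simps)
  have "s m * H = H * s m" for m
  proof -
    have "s m * H = s m * (H * ((1 - exp H ^ 2 ^ m) * s m))"
      by (simp add: inv)
    also have "H * ((1 - exp H ^ 2 ^ m) * s m) = (1 - exp H ^ 2 ^ m) * (H * s m)"
      by (simp only: mult.assoc[symmetric] comm)
    also have "s m * \<dots> = (s m * (1 - exp H ^ 2 ^ m)) * (H * s m)"
      by (simp only: mult.assoc)
    finally show ?thesis by (simp add: inv)
  qed
  moreover have "(\<lambda>m. s m * H) \<longlonglongrightarrow> Q * H" "(\<lambda>m. H * s m) \<longlonglongrightarrow> H * Q"
    by (intro tendsto_intros lim)+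
  ultimately have "H * Q = Q * H"
    using LIMSEQ_unique by force
  then show "hamiltonian A B C ** mat_of Q = mat_of Q ** hamiltonian A B C"
    by (simp flip: times_sqmat.rep_eq mat_of_H)
  define J :: "(complex, 'n + 'n) sqmat" where "J = Sqmat symplectic"
  have mat_of_J: "mat_of J = symplectic" by (simp add: J_def Sqmat_inverse)
  have JJ: "J * - J = 1" "- J * J = 1"
    unfolding mat_of_inject[symmetric] times_sqmat.rep_eq uminus_sqmat.rep_eq one_sqmat.rep_eq mat_of_J
      symplectic_def mat_1_block[where 'b = 'n] block_minus block_mult
    by (simp_all add: matrix_mult_minus_left matrix_mult_minus_right)
  have JH: "J * H * - J = - conj_transpose_sqmat H"
    unfolding mat_of_inject[symmetric] times_sqmat.rep_eq uminus_sqmat.rep_eq mat_of_J mat_of_H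
      mat_of_conj_transpose_sqmat symplectic_def hamiltonian_def conj_transpose_block block_minus block_mult
    by (simp add: matrix_mult_minus_left matrix_mult_minus_right conj_transpose_minus conj_transpose_mult)
  \<comment> \<open>An inner automorphism, because \<open>- J\<close> inverts \<open>J\<close>; it
    sends \<open>H\<close> to minus its adjoint.\<close>
  define h where "h M = J * M * - J" for M
  have h_mult: "h (M * N) = h M * h N" for M N
  proof -
    have "h M * h N = J * M * (- J * J) * N * - J"
      by (simp only: h_def mult.assoc)
    then show ?thesis by (simp only: JJ h_def mult_1_right mult.assoc)
  qed
  have h_1: "h 1 = 1" by (simp only: h_def JJ mult_1_right)
  have h_power: "h (M ^ k) = h M ^ k" for M k
    by (induction k) (simp_all add: h_1 h_mult)
  have "bounded_linear h"
    unfolding h_def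
    by (intro bounded_linear_mult_const bounded_linear_const_mult bounded_linear_ident)
  then have h_exp: "h (exp H) = exp (- conj_transpose_sqmat H)"
    using exp_power_hom[of h H, OF _ h_power] JH by (simp add: h_def)
  have h_diff: "h (M - N) = h M - h N" for M N
    by (simp add: h_def algebra_simps)
  \<comment> \<open>With \<open>Y = exp (- W)\<close> this is the identity
    \<open>1 / (1 - Y) + 1 / (1 - 1 / Y) = 1\<close>.\<close>
  have "h (s m) = 1 - conj_transpose_sqmat (s m)" for m
  proof -
    define W where "W = real (2 ^ m) *\<^sub>R conj_transpose_sqmat H"
    define t where "t = conj_transpose_sqmat (s m)"
    have "h (exp H ^ 2 ^ m) = exp (- conj_transpose_sqmat H) ^ 2 ^ m"
      by (simp only: h_power h_exp)
    also have "\<dots> = exp (real (2 ^ m) *\<^sub>R (- conj_transpose_sqmat H))"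
      by (rule exp_scaleR_of_nat[symmetric])
    finally have Y: "h (exp H ^ 2 ^ m) = exp (- W)"
      by (simp only: W_def scaleR_minus_right)
    have "conj_transpose_sqmat (exp H ^ 2 ^ m) = exp (conj_transpose_sqmat H) ^ 2 ^ m"
      by (simp only: conj_transpose_sqmat_power conj_transpose_sqmat_exp)
    also have "\<dots> = exp W"
      unfolding W_def by (rule exp_scaleR_of_nat[symmetric])
    finally have "conj_transpose_sqmat (1 - exp H ^ 2 ^ m) = 1 - exp W"
      using bounded_linear.linear[OF bounded_linear_conj_transpose_sqmat, THEN linear_diff, of 1 "exp H ^ 2 ^ m"]
      by (simp only: conj_transpose_sqmat_one)
    then have "(1 - exp W) * t = 1"
      using arg_cong[OF inv(2)[of m], of conj_transpose_sqmat]
      by (simp only: conj_transpose_sqmat_mult conj_transpose_sqmat_one t_def)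
    then have Zt: "exp W * t = t - 1" by (simp add: algebra_simps)
    have "exp (- W) * (exp W * t) = t"
      using exp_minus_inverse[of "- W"] by (simp add: mult.assoc[symmetric])
    then have Yt: "exp (- W) * t = t + exp (- W)"
      unfolding Zt by (simp add: algebra_simps)
    have Yinv: "(1 - exp (- W)) * (1 - t) = 1"
      using Yt by (simp add: algebra_simps)
    have "h (s m) * (1 - exp (- W)) = 1"
      using h_mult[of "s m" "1 - exp H ^ 2 ^ m"] by (simp add: inv h_1 h_diff Y)
    then have "h (s m) * ((1 - exp (- W)) * (1 - t)) = 1 - t"
      by (simp only: mult.assoc[symmetric] mult_1_left)
    then have "h (s m) = 1 - t"
      by (simp only: Yinv mult_1_right)
    then show ?thesis by (simp add: t_def)
  qed
  moreover have "(\<lambda>m. h (s m)) \<longlonglongrightarrow> h Q" "(\<lambda>m. 1 - conj_transpose_sqmat (s m)) \<longlonglongrightarrow> 1 - conj_transpose_sqmat Q"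
    by (intro tendsto_intros bounded_linear.tendsto[OF \<open>bounded_linear h\<close>]
        bounded_linear.tendsto[OF bounded_linear_conj_transpose_sqmat] lim)+
  ultimately have "h Q = 1 - conj_transpose_sqmat Q"
    using LIMSEQ_unique by force
  then have "h Q * J = (1 - conj_transpose_sqmat Q) * J" by simp
  moreover have "h Q * J = J * Q * (- J * J)"
    by (simp only: h_def mult.assoc)
  ultimately have "J * Q = (1 - conj_transpose_sqmat Q) * J"
    by (simp only: JJ mult_1_right)
  from arg_cong[OF this, of mat_of]
  show "symplectic ** mat_of Q = (mat 1 - conj_transpose (mat_of Q)) ** symplectic"
    by (simp add: times_sqmat.rep_eq minus_sqmat.rep_eq one_sqmat.rep_eq mat_of_conj_transpose_sqmat mat_of_J)
  fix v l assume v: "v \<noteq> 0" "hamiltonian A B C *v v = l *s v" "mat_of Q *v v = v"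
  show "Re l < 0"
  proof (rule ccontr)
    assume "\<not> Re l < 0"
    moreover have "Re l \<noteq> 0"
      using hamiltonian_no_imaginary_eigenvalue[OF stab v(2)] v(1) by blast
    ultimately have "Re l > 0" by simp
    have "mat_of (exp H ^ k) *v v = exp l ^ k *s v" for k
    proof (induction k)
      case (Suc k)
      have "mat_of (exp H ^ Suc k) *v v = mat_of (exp H) *v (mat_of (exp H ^ k) *v v)"
        by (simp add: times_sqmat.rep_eq matrix_vector_mul_assoc)
      also have "\<dots> = exp l ^ k *s (exp l *s v)"
        using exp_eigenvector[of H v l] v(2) by (simp add: Suc mat_of_H vector_scalar_commute)
      finally show ?case by (simp add: vector_smult_assoc mult.commute)
    qed (simp add: one_sqmat.rep_eq)
    then have *: "mat_of (1 - exp H ^ k) *v v = (1 - exp l ^ k) *s v" for k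
      by (simp add: minus_sqmat.rep_eq one_sqmat.rep_eq matrix_vector_mult_diff_rdistrib vec.scale_left_diff_distrib)
    \<comment> \<open>On \<open>v\<close> the matrix \<open>s m\<close> acts as the inverse of
      \<open>1 - exp l ^ 2 ^ m\<close>. Multiplication by \<open>exp (- l) ^ 2 ^ m\<close> removes
      the divergent term, and the limit reads \<open>0 = - Q v\<close>.\<close>
    have "exp (- l) ^ 2 ^ m *s v = (exp (- l) ^ 2 ^ m - 1) *s (mat_of (s m) *v v)" for m
    proof -
      have "v = mat_of (s m * (1 - exp H ^ 2 ^ m)) *v v"
        by (simp add: inv one_sqmat.rep_eq)
      also have "\<dots> = (1 - exp l ^ 2 ^ m) *s (mat_of (s m) *v v)"
        by (simp only: times_sqmat.rep_eq matrix_vector_mul_assoc[symmetric] * vector_scalar_commute)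
      finally have "exp (- l) ^ 2 ^ m *s v = (exp (- l) ^ 2 ^ m * (1 - exp l ^ 2 ^ m)) *s (mat_of (s m) *v v)"
        by (metis vector_smult_assoc)
      also have "exp (- l) ^ 2 ^ m * (1 - exp l ^ 2 ^ m) = exp (- l) ^ 2 ^ m - 1"
        by (simp add: right_diff_distrib exp_minus power_mult_distrib[symmetric])
      finally show ?thesis .
    qed
    then have eq: "exp (- l) ^ 2 ^ m * v $ i = (exp (- l) ^ 2 ^ m - 1) * (mat_of (s m) *v v) $ i" for m i
      by (metis vector_smult_component)
    have "cmod (exp (- l)) < 1" using \<open>Re l > 0\<close> by simp
    then have "(\<lambda>k. exp (- l) ^ k) \<longlonglongrightarrow> 0" by (rule LIMSEQ_power_zero)
    moreover have "strict_mono (\<lambda>m. 2 ^ m :: nat)" by (rule strict_monoI) simp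
    ultimately have lim0: "(\<lambda>m. exp (- l) ^ 2 ^ m) \<longlonglongrightarrow> 0"
      using LIMSEQ_subseq_LIMSEQ[of _ 0 "\<lambda>m. 2 ^ m"] by (simp add: o_def)
    have "v $ i = 0" for i
    proof -
      have "(\<lambda>m. (exp (- l) ^ 2 ^ m - 1) * (mat_of (s m) *v v) $ i) \<longlonglongrightarrow> (0 - 1) * (mat_of Q *v v) $ i"
        by (intro tendsto_intros lim0 tendsto_mult_vec lim)
      moreover have "(\<lambda>m. (exp (- l) ^ 2 ^ m - 1) * (mat_of (s m) *v v) $ i) \<longlonglongrightarrow> 0 * v $ i"
        unfolding eq[symmetric] by (intro tendsto_intros lim0)
      ultimately have "(0 - 1) * (mat_of Q *v v) $ i = 0 * v $ i"
        by (rule LIMSEQ_unique)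
      then show ?thesis using v(3) by simp
    qed
    then show False using v(1) by (simp add: vec_eq_iff)
  qed
qed

text \<open>The quadratic form of \<open>P\<close> decreases to zero along the flow of \<open>K\<close>.\<close>

lemma lyapunov_nonneg:
  fixes K P :: "complex ^ 'n ^ 'n"
  assumes decay: "((\<lambda>t. exp (t *\<^sub>R Sqmat K)) \<longlongrightarrow> 0) at_top"
    and lyapunov: "\<And>u. Re (cinner u ((conj_transpose K ** P + P ** K) *v u)) \<le> 0"
  shows "0 \<le> Re (cinner v (P *v v))"
proof -
  define E where "E t = exp (t *\<^sub>R Sqmat K)" for t :: real
  define E' where "E' t = conj_transpose_sqmat (E t)" for t
  define h where "h M = Re (cinner v (mat_of M *v v))" for M
  have h: "bounded_linear h"
    unfolding h_def cinner_def matrix_vector_mult_def vec_lambda_beta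
    by (intro bounded_linear_compose[OF bounded_linear_Re] bounded_linear_sum
        bounded_linear_const_mult bounded_linear_mult_const bounded_linear_entry)
  define F where "F t = E' t * Sqmat P * E t" for t
  have dE: "(E has_vector_derivative Sqmat K * E t) (at t)" for t
    unfolding E_def by (rule exp_scaleR_has_vector_derivative_left)
  have dE': "(E' has_vector_derivative E' t * conj_transpose_sqmat (Sqmat K)) (at t)" for t
    using bounded_linear.has_vector_derivative[OF bounded_linear_conj_transpose_sqmat dE]
    by (simp add: E'_def[abs_def] conj_transpose_sqmat_mult)
  have dF: "(F has_vector_derivative E' t * (conj_transpose_sqmat (Sqmat K) * Sqmat P + Sqmat P * Sqmat K) * E t) (at t)" for t
  proof -
    have "((\<lambda>t. E' t * Sqmat P) has_vector_derivative (E' t * conj_transpose_sqmat (Sqmat K)) * Sqmat P) (at t)"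
      by (rule bounded_linear.has_vector_derivative[OF bounded_linear_mult_left dE'])
    from has_vector_derivative_mult[OF this dE] show ?thesis
      unfolding F_def by (simp add: algebra_simps)
  qed
  have h_quad: "h (E' t * M * E t) = Re (cinner (mat_of (E t) *v v) (mat_of M *v (mat_of (E t) *v v)))" for t M
    by (simp add: h_def times_sqmat.rep_eq E'_def mat_of_conj_transpose_sqmat
        cinner_mult_right[of v] flip: matrix_vector_mul_assoc)
  have "((\<lambda>t. h (F t)) has_real_derivative
      h (E' t * (conj_transpose_sqmat (Sqmat K) * Sqmat P + Sqmat P * Sqmat K) * E t)) (at t)" for t
    using bounded_linear.has_vector_derivative[OF h dF]
    by (simp add: has_real_derivative_iff_has_vector_derivative)
  moreover have "h (E' t * (conj_transpose_sqmat (Sqmat K) * Sqmat P + Sqmat P * Sqmat K) * E t) \<le> 0" for t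
    unfolding h_quad
    using lyapunov by (simp add: plus_sqmat.rep_eq times_sqmat.rep_eq mat_of_conj_transpose_sqmat Sqmat_inverse)
  ultimately have mono: "h (F t) \<le> h (F 0)" if "0 \<le> t" for t
    using DERIV_nonpos_imp_nonincreasing[OF that, of "\<lambda>t. h (F t)"] by blast
  have "(E \<longlongrightarrow> 0) at_top" using decay by (simp add: E_def[abs_def])
  moreover from this have "(E' \<longlongrightarrow> 0) at_top"
    unfolding E'_def by (rule bounded_linear.tendsto_zero[OF bounded_linear_conj_transpose_sqmat])
  ultimately have "(F \<longlongrightarrow> 0 * Sqmat P * 0) at_top"
    unfolding F_def by (intro tendsto_mult tendsto_const)
  then have "((\<lambda>t. h (F t)) \<longlongrightarrow> 0) at_top"
    by (intro bounded_linear.tendsto_zero[OF h]) simp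
  moreover have "eventually (\<lambda>t. h (F t) \<le> h (F 0)) at_top"
    using eventually_ge_at_top[of 0] by eventually_elim (rule mono)
  ultimately have "0 \<le> h (F 0)"
    by (intro tendsto_upperbound) auto
  then show ?thesis
    unfolding F_def h_quad by (simp add: E_def one_sqmat.rep_eq Sqmat_inverse)
qed

section \<open>Lifting to the Banach algebra\<close>

lemma matrix_diff_rdistrib: "(M - M') ** N = M ** N - M' ** N" for M :: "'a::ring_1 ^ 'n ^ 'm"
  by (simp add: vec_eq_iff matrix_matrix_mult_def left_diff_distrib sum_subtractf)

definition scalar_sqmat :: "complex \<Rightarrow> ('a::comm_complex_banach_algebra_1, 'n::finite) sqmat" where
  "scalar_sqmat z = Sqmat (mat (z *\<^sub>C 1))"

lemma mat_of_scalar_sqmat_mult: "mat_of (scalar_sqmat z * M) $ i $ j = z *\<^sub>C (mat_of M $ i $ j)"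
proof -
  have "mat_of (scalar_sqmat z * M) $ i $ j = (\<Sum>k\<in>UNIV. (if i = k then z *\<^sub>C 1 else 0) * mat_of M $ k $ j)"
    by (simp add: scalar_sqmat_def times_sqmat.rep_eq Sqmat_inverse matrix_matrix_mult_def mat_def)
  also have "\<dots> = (\<Sum>k\<in>UNIV. if i = k then z *\<^sub>C 1 * mat_of M $ k $ j else 0)"
    by (intro sum.cong) auto
  finally show ?thesis by (simp add: mult_scaleC_left)
qed

lemma mat_of_mult_scalar_sqmat: "mat_of (M * scalar_sqmat z) $ i $ j = z *\<^sub>C (mat_of M $ i $ j)"
proof -
  have "mat_of (M * scalar_sqmat z) $ i $ j = (\<Sum>k\<in>UNIV. mat_of M $ i $ k * (if k = j then z *\<^sub>C 1 else 0))"
    by (simp add: scalar_sqmat_def times_sqmat.rep_eq Sqmat_inverse matrix_matrix_mult_def mat_def)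
  also have "\<dots> = (\<Sum>k\<in>UNIV. if k = j then z *\<^sub>C 1 * mat_of M $ i $ k else 0)"
    by (intro sum.cong) (auto simp: mult.commute)
  finally show ?thesis by (simp add: mult_scaleC_left)
qed

lemma sqmat_eqI: "(\<And>i j. mat_of M $ i $ j = mat_of N $ i $ j) \<Longrightarrow> M = N"
  by (simp add: mat_of_inject[symmetric] vec_eq_iff)

lemma seminormed_algebra_sqmat:
  "seminormed_algebra (norm :: ('a::comm_complex_banach_algebra_1, 'n::finite) sqmat \<Rightarrow> real) scalar_sqmat"
proof
  fix z w :: complex and x y :: "('a, 'n) sqmat"
  show "norm (x + y) \<le> norm x + norm y" by (rule norm_triangle_ineq)
  show "norm (x * y) \<le> norm x * norm y" by (rule norm_mult_ineq)
  show "norm (scalar_sqmat z * x) \<le> cmod z * norm x"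
    unfolding norm_sqmat.rep_eq row_sum_norm_le_iff
    by (simp add: mat_of_scalar_sqmat_mult norm_scaleC sum_distrib_left[symmetric] mult_left_mono row_le_row_sum_norm)
  show "scalar_sqmat z * x = x * scalar_sqmat z"
    by (rule sqmat_eqI) (simp add: mat_of_scalar_sqmat_mult mat_of_mult_scalar_sqmat)
  show "scalar_sqmat (z * w) = scalar_sqmat z * (scalar_sqmat w :: ('a, 'n) sqmat)"
  proof (rule sqmat_eqI)
    fix i j
    have "0 = u *\<^sub>C (0 :: 'a)" for u using norm_scaleC[of u "0 :: 'a"] by simp
    then show "mat_of (scalar_sqmat (z * w) :: ('a, 'n) sqmat) $ i $ j = mat_of (scalar_sqmat z * (scalar_sqmat w :: ('a, 'n) sqmat)) $ i $ j"
      unfolding mat_of_scalar_sqmat_mult by (simp add: scalar_sqmat_def Sqmat_inverse mat_def scaleC_scaleC)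
  qed
  show "scalar_sqmat (z + w) = scalar_sqmat z + (scalar_sqmat w :: ('a, 'n) sqmat)"
    by (rule sqmat_eqI) (simp add: scalar_sqmat_def plus_sqmat.rep_eq Sqmat_inverse mat_def scaleC_add_left)
  show "scalar_sqmat 1 = (1 :: ('a, 'n) sqmat)"
    by (simp add: scalar_sqmat_def scaleC_1 one_sqmat_def)
qed simp_all

lemma (in character) gelfand_sqmat_scalar_mult:
  "mat_of (gelfand_sqmat \<phi> (1 - scalar_sqmat z * M)) *v v = v - z *s (mat_of (gelfand_sqmat \<phi> M) *v v)"
proof -
  have "mat_of (gelfand_sqmat \<phi> (scalar_sqmat z * M)) $ i $ j = z * mat_of (gelfand_sqmat \<phi> M) $ i $ j" for i j
    unfolding mat_of_gelfand_sqmat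
    by (simp add: gelfand_mat_def gelfand_def mat_of_scalar_sqmat_mult scaleC)
  then have "mat_of (gelfand_sqmat \<phi> (scalar_sqmat z * M)) *v v = z *s (mat_of (gelfand_sqmat \<phi> M) *v v)"
    by (simp add: vec_eq_iff matrix_vector_mult_def sum_distrib_left mult.assoc)
  then show ?thesis
    by (simp add: mat_of_gelfand_sqmat minus_sqmat.rep_eq one_sqmat.rep_eq gelfand_mat_diff
        gelfand_mat_one matrix_vector_mult_diff_rdistrib)
qed

text \<open>A kernel vector at a character is an eigenvector of the exponential for
  \<open>inverse z\<close>, which comes from an eigenvalue \<open>l\<close> with
  \<open>exp l = inverse z\<close>.\<close>

lemma resolvent_of_exp_exists:
  fixes M :: "('a::comm_complex_banach_algebra_1, 'n::finite) sqmat"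
  assumes "\<And>\<phi> v l. \<phi> \<in> maximal_ideal_space \<Longrightarrow> v \<noteq> 0 \<Longrightarrow>
    gelfand_mat (mat_of M) \<phi> *v v = l *s v \<Longrightarrow> z * exp l \<noteq> 1"
  shows "\<exists>y. (1 - scalar_sqmat z * exp M) * y = 1 \<and> y * (1 - scalar_sqmat z * exp M) = 1"
proof (rule sqmat_unit_of_trivial_kernels)
  fix \<phi> :: "'a \<Rightarrow> complex" and v :: "complex ^ 'n"
  assume \<phi>: "\<phi> \<in> maximal_ideal_space"
  interpret character \<phi> by unfold_locales fact
  let ?M = "gelfand_sqmat \<phi> M"
  assume "mat_of (gelfand_sqmat \<phi> (1 - scalar_sqmat z * exp M)) *v v = 0"
  then have v: "z *s (mat_of (exp ?M) *v v) = v"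
    by (simp add: gelfand_sqmat_scalar_mult gelfand_sqmat_exp)
  show "v = 0"
  proof (rule ccontr)
    assume "v \<noteq> 0"
    then have "z \<noteq> 0" using v by auto
    then have "mat_of (exp ?M) *v v = inverse z *s (z *s (mat_of (exp ?M) *v v))"
      by (simp add: vector_smult_assoc)
    then have "mat_of (exp ?M) *v v = inverse z *s v"
      by (simp only: v)
    then obtain w l where w: "w \<noteq> 0" "mat_of ?M *v w = l *s w" "exp l = inverse z"
      using eigenvector_of_exp \<open>v \<noteq> 0\<close> by blast
    then show False
      using assms[OF \<phi> w(1), of l] \<open>z \<noteq> 0\<close> by (simp add: mat_of_gelfand_sqmat)
  qed
qed

text \<open>The eigenvalues at the characters come without a common margin. Uniform decay results
  from inverting \<open>1 - z exp K\<close> on the whole closed unit disc, which yields a power of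
  \<open>exp K\<close> of norm at most \<open>1 / 2\<close>.\<close>

lemma exponentially_stable_exp_bound:
  fixes K :: "'a::comm_complex_banach_algebra_1 ^ 'n ^ 'n"
  assumes "\<And>\<phi> v l. \<phi> \<in> maximal_ideal_space \<Longrightarrow> v \<noteq> 0 \<Longrightarrow> gelfand_mat K \<phi> *v v = l *s v \<Longrightarrow> Re l < 0"
  shows "\<exists>L>0. \<exists>\<epsilon>>0. \<forall>t\<ge>0. norm (exp (t *\<^sub>R Sqmat K)) \<le> L * exp (- \<epsilon> * t)"
proof -
  interpret seminormed_algebra "norm :: ('a, 'n) sqmat \<Rightarrow> real" scalar_sqmat
    by (rule seminormed_algebra_sqmat)
  have "\<exists>y. is_inverse (1 - scalar_sqmat z * exp (Sqmat K)) y" if "cmod z \<le> 1" for z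
  proof -
    have "z * exp l \<noteq> 1" if "\<phi> \<in> maximal_ideal_space" "v \<noteq> 0" "gelfand_mat K \<phi> *v v = l *s v" for \<phi> v l
    proof
      assume "z * exp l = 1"
      then have "cmod z * exp (Re l) = 1"
        by (metis norm_exp_eq_Re norm_mult norm_one)
      moreover have "cmod z * exp (Re l) \<le> 1 * exp (Re l)"
        using \<open>cmod z \<le> 1\<close> by (intro mult_right_mono) auto
      moreover have "exp (Re l) < 1" using assms[OF that] by simp
      ultimately show False by simp
    qed
    then show ?thesis
      using resolvent_of_exp_exists[of "Sqmat K" z]
      by (simp add: Sqmat_inverse is_inverse_def eqv_def)
  qed
  then obtain f where "\<And>z. cmod z \<le> 1 \<Longrightarrow> is_inverse (1 - scalar_sqmat z * exp (Sqmat K)) (f z)"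
    by metis
  then obtain m where "norm (exp (Sqmat K) ^ 2 ^ m) \<le> 1 / 2"
    using power_seminorm_less_1 by blast
  then show ?thesis
    by (rule exp_decay) simp
qed

text \<open>The Riccati equation is a Lyapunov equation for the closed loop \<open>K\<close>, with
  the negative semidefinite right side \<open>- P B B* P - C* C\<close>.\<close>

lemma riccati_pos_semidef:
  fixes A :: "complex ^ 'n ^ 'n" and B :: "complex ^ 'm ^ 'n" and C :: "complex ^ 'n ^ 'p"
  assumes "P ** (B ** conj_transpose B) ** P - P ** A - conj_transpose A ** P - conj_transpose C ** C = 0"
    and herm: "conj_transpose P = P"
    and "K = A - B ** conj_transpose B ** P"
    and decay: "((\<lambda>t. exp (t *\<^sub>R Sqmat K)) \<longlongrightarrow> 0) at_top"
  shows "pos_semidef P"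
proof -
  have "conj_transpose K ** P + P ** K = - (P ** (B ** conj_transpose B) ** P) - conj_transpose C ** C"
  proof -
    have "conj_transpose K = conj_transpose A - P ** (B ** conj_transpose B)"
      by (simp add: assms(3) conj_transpose_diff conj_transpose_mult herm matrix_mul_assoc)
    then have "conj_transpose K ** P + P ** K =
        conj_transpose A ** P + P ** A - P ** (B ** conj_transpose B) ** P - P ** (B ** conj_transpose B) ** P"
      by (simp add: assms(3) matrix_diff_ldistrib matrix_diff_rdistrib matrix_mul_assoc)
    also have "\<dots> = - (P ** (B ** conj_transpose B) ** P) - conj_transpose C ** C
        - (P ** (B ** conj_transpose B) ** P - P ** A - conj_transpose A ** P - conj_transpose C ** C)"
      by (simp add: algebra_simps)
    finally show ?thesis by (simp only: assms(1) diff_zero)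
  qed
  moreover have "Re (cinner u ((- (P ** (B ** conj_transpose B) ** P) - conj_transpose C ** C) *v u)) \<le> 0" for u
  proof -
    have "cinner u ((- (P ** (B ** conj_transpose B) ** P) - conj_transpose C ** C) *v u)
        = - cinner (conj_transpose B *v (P *v u)) (conj_transpose B *v (P *v u)) - cinner (C *v u) (C *v u)"
      by (simp add: matrix_vector_mult_diff_rdistrib matrix_vector_mult_minus_left cinner_diff_right
          cinner_minus_right cinner_mult_right[of u P] cinner_mult_right[of _ B]
          cinner_mult_right[of u "conj_transpose C"] herm flip: matrix_vector_mul_assoc)
    then show ?thesis
      using cinner_self_nonneg[of "conj_transpose B *v (P *v u)"] cinner_self_nonneg[of "C *v u"] by simp
  qed
  ultimately have "0 \<le> Re (cinner v (P *v v))" for v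
    using lyapunov_nonneg[OF decay] by simp
  then show ?thesis
    using herm by (simp add: pos_semidef_def cinner_def)
qed

theorem theorem1p4:
  fixes star :: "'a::comm_complex_banach_algebra_1 \<Rightarrow> 'a"
    and A :: "'a ^ 'n ^ 'n"
    and B :: "'a ^ 'm ^ 'n"
    and C :: "'a ^ 'n ^ 'p"
  assumes "semisimple TYPE('a)"
    and "involution star"
    and A1: "\<And>\<phi>. \<phi> \<in> maximal_ideal_space \<Longrightarrow>
      gelfand_mat (star_mat star A) \<phi> = conj_transpose (gelfand_mat A \<phi>)"
    and A2: "\<And>\<phi>. \<phi> \<in> maximal_ideal_space \<Longrightarrow>
      gelfand_mat (B ** star_mat star B) \<phi> = gelfand_mat B \<phi> ** conj_transpose (gelfand_mat B \<phi>)"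
    and A3: "\<And>\<phi>. \<phi> \<in> maximal_ideal_space \<Longrightarrow>
      gelfand_mat (star_mat star C ** C) \<phi> = conj_transpose (gelfand_mat C \<phi>) ** gelfand_mat C \<phi>"
    and A4: "\<And>\<phi>. \<phi> \<in> maximal_ideal_space \<Longrightarrow>
      stabilizable (gelfand_mat A \<phi>) (gelfand_mat B \<phi>)"
    and A5: "\<And>\<phi>. \<phi> \<in> maximal_ideal_space \<Longrightarrow>
      detectable (gelfand_mat A \<phi>) (gelfand_mat C \<phi>)"
  shows "\<exists>P :: 'a ^ 'n ^ 'n.
    P ** B ** star_mat star B ** P - P ** A - star_mat star A ** P - star_mat star C ** C = 0 \<and>
    exponentially_stable (A - B ** star_mat star B ** P) \<and>
    (\<forall>\<phi>\<in>maximal_ideal_space. pos_semidef (gelfand_mat P \<phi>))"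
proof -
  define D where "D = B ** star_mat star B"
  define H where "H = Sqmat (block A (- D) (- (star_mat star C ** C)) (- star_mat star A))"
  let ?H = "\<lambda>\<phi>. hamiltonian (gelfand_mat A \<phi>) (gelfand_mat B \<phi>) (gelfand_mat C \<phi>)"
  have H: "gelfand_mat (mat_of H) \<phi> = ?H \<phi>" if "\<phi> \<in> maximal_ideal_space" for \<phi>
  proof -
    interpret character \<phi> by unfold_locales fact
    show ?thesis
      using that by (simp add: H_def D_def Sqmat_inverse gelfand_mat_block gelfand_mat_minus hamiltonian_def A1 A2 A3)
  qed
  have "\<exists>y. (1 - scalar_sqmat z * exp H) * y = 1 \<and> y * (1 - scalar_sqmat z * exp H) = 1" if "cmod z = 1" for z
  proof (rule resolvent_of_exp_exists, rule notI)
    fix \<phi> v l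
    assume \<phi>: "\<phi> \<in> maximal_ideal_space" and v: "v \<noteq> 0" "gelfand_mat (mat_of H) \<phi> *v v = l *s v"
    assume "z * exp l = 1"
    then have "cmod z * exp (Re l) = 1"
      by (metis norm_exp_eq_Re norm_mult norm_one)
    then have "Re l = 0" using that by simp
    with v show False
      using hamiltonian_no_imaginary_eigenvalue[OF A4[OF \<phi>] A5[OF \<phi>], of v l] by (simp add: H[OF \<phi>])
  qed
  then obtain Q s where Q: "s \<longlonglongrightarrow> Q" "Q * Q = Q"
    and s: "\<And>m. (1 - exp H ^ 2 ^ m) * s m = 1" "\<And>m. s m * (1 - exp H ^ 2 ^ m) = 1"
    using spectral_idempotent[OF seminormed_algebra_sqmat, of "exp H"] by blast
  obtain Q11 Q12 Q21 Q22 where Q_block: "mat_of Q = block Q11 Q12 Q21 Q22"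
    using block_exhaust by blast
  have projection: "hamiltonian_projection (gelfand_mat A \<phi>) (gelfand_mat B \<phi>) (gelfand_mat C \<phi>)
      (block (gelfand_mat Q11 \<phi>) (gelfand_mat Q12 \<phi>) (gelfand_mat Q21 \<phi>) (gelfand_mat Q22 \<phi>))"
    if \<phi>: "\<phi> \<in> maximal_ideal_space" for \<phi>
  proof -
    interpret character \<phi> by unfold_locales fact
    have "gelfand_sqmat \<phi> H = Sqmat (?H \<phi>)"
      by (simp add: gelfand_sqmat_def H[OF \<phi>])
    then have E: "gelfand_sqmat \<phi> (1 - exp H ^ k) = 1 - exp (Sqmat (?H \<phi>)) ^ k" for k
      using bounded_linear.linear[OF bounded_linear_gelfand_sqmat, THEN linear_diff, of 1 "exp H ^ k"]
      by (simp add: gelfand_sqmat_one gelfand_sqmat_power gelfand_sqmat_exp)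
    have "hamiltonian_projection (gelfand_mat A \<phi>) (gelfand_mat B \<phi>) (gelfand_mat C \<phi>) (mat_of (gelfand_sqmat \<phi> Q))"
    proof (rule hamiltonian_projection_limit[OF A4[OF \<phi>] A5[OF \<phi>]])
      show "(\<lambda>m. gelfand_sqmat \<phi> (s m)) \<longlonglongrightarrow> gelfand_sqmat \<phi> Q"
        by (rule bounded_linear.tendsto[OF bounded_linear_gelfand_sqmat Q(1)])
      show "gelfand_sqmat \<phi> Q * gelfand_sqmat \<phi> Q = gelfand_sqmat \<phi> Q"
        by (simp add: Q(2) flip: gelfand_sqmat_mult)
      show "(1 - exp (Sqmat (?H \<phi>)) ^ 2 ^ m) * gelfand_sqmat \<phi> (s m) = 1"
        "gelfand_sqmat \<phi> (s m) * (1 - exp (Sqmat (?H \<phi>)) ^ 2 ^ m) = 1" for m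
        by (simp_all add: s gelfand_sqmat_one flip: E gelfand_sqmat_mult)
    qed
    then show ?thesis
      by (simp add: mat_of_gelfand_sqmat Q_block gelfand_mat_block)
  qed
  define G where "G = Q12 ** Q12 + Q11 ** (mat 1 - Q22)"
  have "\<exists>N. Sqmat G * N = 1 \<and> N * Sqmat G = 1"
  proof (rule sqmat_unit_of_trivial_kernels)
    fix \<phi> :: "'a \<Rightarrow> complex" and v
    assume \<phi>: "\<phi> \<in> maximal_ideal_space"
    interpret character \<phi> by unfold_locales fact
    interpret hamiltonian_projection "gelfand_mat A \<phi>" "gelfand_mat B \<phi>" "gelfand_mat C \<phi>"
      "block (gelfand_mat Q11 \<phi>) (gelfand_mat Q12 \<phi>) (gelfand_mat Q21 \<phi>) (gelfand_mat Q22 \<phi>)"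
      by (rule projection[OF \<phi>])
    assume "mat_of (gelfand_sqmat \<phi> (Sqmat G)) *v v = 0"
    then show "v = 0"
      by - (rule gram_kernel[OF refl],
        simp add: mat_of_gelfand_sqmat Sqmat_inverse G_def gelfand_mat_add gelfand_mat_mult gelfand_mat_diff gelfand_mat_one)
  qed
  then obtain N where "Sqmat G * N = 1" by blast
  then have "mat_of (Sqmat G) ** mat_of N = mat 1"
    by (simp flip: times_sqmat.rep_eq one_sqmat.rep_eq)
  then obtain R where R: "G ** R = mat 1"
    by (auto simp: Sqmat_inverse)
  define P where "P = (Q21 ** (mat 1 - Q22) + Q22 ** Q12) ** R"
  have P: "conj_transpose (gelfand_mat P \<phi>) = gelfand_mat P \<phi>"
    "gelfand_mat (P ** D ** P - P ** A - star_mat star A ** P - star_mat star C ** C) \<phi> = 0"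
    "gelfand_mat P \<phi> ** (gelfand_mat B \<phi> ** conj_transpose (gelfand_mat B \<phi>)) ** gelfand_mat P \<phi>
      - gelfand_mat P \<phi> ** gelfand_mat A \<phi> - conj_transpose (gelfand_mat A \<phi>) ** gelfand_mat P \<phi>
      - conj_transpose (gelfand_mat C \<phi>) ** gelfand_mat C \<phi> = 0"
    "gelfand_mat (A - D ** P) \<phi> =
      gelfand_mat A \<phi> - gelfand_mat B \<phi> ** conj_transpose (gelfand_mat B \<phi>) ** gelfand_mat P \<phi>"
    "\<And>v l. v \<noteq> 0 \<Longrightarrow> gelfand_mat (A - D ** P) \<phi> *v v = l *s v \<Longrightarrow> Re l < 0"
    if \<phi>: "\<phi> \<in> maximal_ideal_space" for \<phi>
  proof -
    interpret character \<phi> by unfold_locales fact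
    interpret hamiltonian_projection "gelfand_mat A \<phi>" "gelfand_mat B \<phi>" "gelfand_mat C \<phi>"
      "block (gelfand_mat Q11 \<phi>) (gelfand_mat Q12 \<phi>) (gelfand_mat Q21 \<phi>) (gelfand_mat Q22 \<phi>)"
      by (rule projection[OF \<phi>])
    note hom = gelfand_mat_add gelfand_mat_mult gelfand_mat_diff gelfand_mat_one
    have inv: "(gelfand_mat Q12 \<phi> ** gelfand_mat Q12 \<phi> + gelfand_mat Q11 \<phi> ** (mat 1 - gelfand_mat Q22 \<phi>)) ** gelfand_mat R \<phi> = mat 1"
      using arg_cong[OF R, of "\<lambda>M. gelfand_mat M \<phi>"] by (simp add: G_def hom)
    have eq: "gelfand_mat P \<phi> = (gelfand_mat Q21 \<phi> ** (mat 1 - gelfand_mat Q22 \<phi>)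
        + gelfand_mat Q22 \<phi> ** gelfand_mat Q12 \<phi>) ** gelfand_mat R \<phi>"
      by (simp add: P_def hom)
    show "conj_transpose (gelfand_mat P \<phi>) = gelfand_mat P \<phi>"
      unfolding eq by (rule riccati_hermitian[OF refl inv])
    show riccati: "gelfand_mat P \<phi> ** (gelfand_mat B \<phi> ** conj_transpose (gelfand_mat B \<phi>)) ** gelfand_mat P \<phi>
      - gelfand_mat P \<phi> ** gelfand_mat A \<phi> - conj_transpose (gelfand_mat A \<phi>) ** gelfand_mat P \<phi>
      - conj_transpose (gelfand_mat C \<phi>) ** gelfand_mat C \<phi> = 0"
      unfolding eq by (rule riccati_equation[OF refl inv])
    \<comment> \<open>Multiplicativity is instantiated so as not to split
      \<open>B ** star_mat star B\<close> or \<open>star_mat star C ** C\<close>: the hypotheses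
      give transforms only of these products.\<close>
    show "gelfand_mat (P ** D ** P - P ** A - star_mat star A ** P - star_mat star C ** C) \<phi> = 0"
      using riccati by (simp add: gelfand_mat_diff gelfand_mat_mult[of "_ ** _" P] gelfand_mat_mult[of P]
          gelfand_mat_mult[of _ P] D_def A1[OF \<phi>] A2[OF \<phi>] A3[OF \<phi>])
    show K: "gelfand_mat (A - D ** P) \<phi> =
      gelfand_mat A \<phi> - gelfand_mat B \<phi> ** conj_transpose (gelfand_mat B \<phi>) ** gelfand_mat P \<phi>"
      by (simp add: gelfand_mat_diff gelfand_mat_mult[of _ P] D_def A2[OF \<phi>])
    show "Re l < 0" if "v \<noteq> 0" "gelfand_mat (A - D ** P) \<phi> *v v = l *s v" for v l
      using that unfolding K eq by (rule riccati_stable[OF refl inv])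
  qed
  have "P ** D ** P - P ** A - star_mat star A ** P - star_mat star C ** C = 0"
  proof -
    have "(P ** D ** P - P ** A - star_mat star A ** P - star_mat star C ** C) $ i $ j = 0" for i j
      using P(2) by (intro semisimple_eq_0[OF assms(1)]) (simp add: vec_eq_iff gelfand_mat_def gelfand_def)
    then show ?thesis by (simp add: vec_eq_iff)
  qed
  moreover obtain L \<epsilon> where L: "L > 0" "\<epsilon> > 0"
    "\<And>t. t \<ge> 0 \<Longrightarrow> norm (exp (t *\<^sub>R Sqmat (A - D ** P))) \<le> L * exp (- \<epsilon> * t)"
    using exponentially_stable_exp_bound[of "A - D ** P"] P(5) by blast
  have "op_norm (mat_exp (t *\<^sub>R (A - D ** P))) \<le> L * exp (- \<epsilon> * t)" if "t \<ge> 0" for t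
  proof -
    have "Sqmat (t *\<^sub>R (A - D ** P)) = t *\<^sub>R Sqmat (A - D ** P)"
      by (simp add: scaleR_sqmat.abs_eq)
    then have "op_norm (mat_exp (t *\<^sub>R (A - D ** P))) \<le> norm (exp (t *\<^sub>R Sqmat (A - D ** P)))"
      using op_norm_le[of "mat_exp (t *\<^sub>R (A - D ** P))"] by (simp add: mat_exp_eq mat_of_inverse)
    also have "\<dots> \<le> L * exp (- \<epsilon> * t)" by (rule L(3)[OF that])
    finally show ?thesis .
  qed
  then have "exponentially_stable (A - D ** P)"
    unfolding exponentially_stable_def using L(1,2) by blast
  \<comment> \<open>The decay at \<open>\<phi>\<close> is the decay in the algebra pushed down by
    the bounded map \<open>gelfand_sqmat \<phi>\<close>.\<close>
  moreover have "pos_semidef (gelfand_mat P \<phi>)" if \<phi>: "\<phi> \<in> maximal_ideal_space" for \<phi>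
  proof (rule riccati_pos_semidef[OF P(3)[OF \<phi>] P(1)[OF \<phi>] P(4)[OF \<phi>]])
    interpret character \<phi> by unfold_locales fact
    have "((\<lambda>t. exp (- (\<epsilon> * t))) \<longlongrightarrow> 0) at_top"
      by (intro filterlim_compose[OF exp_at_bot] filterlim_uminus_at_bot_at_top[THEN filterlim_compose]
          filterlim_tendsto_pos_mult_at_top[OF tendsto_const L(2) filterlim_ident])
    then have "((\<lambda>t. L * exp (- \<epsilon> * t)) \<longlongrightarrow> 0) at_top"
      by (intro tendsto_mult_right_zero) simp
    then have "((\<lambda>t. exp (t *\<^sub>R Sqmat (A - D ** P))) \<longlongrightarrow> 0) at_top"
    proof (rule Lim_null_comparison[rotated])
      show "eventually (\<lambda>t. norm (exp (t *\<^sub>R Sqmat (A - D ** P))) \<le> L * exp (- \<epsilon> * t)) at_top"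
        using eventually_ge_at_top[of 0] by eventually_elim (rule L(3))
    qed
    moreover have "gelfand_sqmat \<phi> (exp (t *\<^sub>R Sqmat (A - D ** P)))
        = exp (t *\<^sub>R Sqmat (gelfand_mat (A - D ** P) \<phi>))" for t
      using bounded_linear.linear[OF bounded_linear_gelfand_sqmat, THEN linear_scale, of t "Sqmat (A - D ** P)"]
      by (simp only: gelfand_sqmat_exp) (simp add: gelfand_sqmat_def Sqmat_inverse)
    ultimately show "((\<lambda>t. exp (t *\<^sub>R Sqmat (gelfand_mat (A - D ** P) \<phi>))) \<longlongrightarrow> 0) at_top"
      using bounded_linear.tendsto_zero[OF bounded_linear_gelfand_sqmat] by fastforce
  qed
  ultimately show ?thesis
    by (intro exI[of _ P]) (simp add: D_def matrix_mul_assoc)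
qed

end
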